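(* Let $\mathcal{S}=\mathbb{R}/2\mathbb{Z}$ with the metric $\rho(x,y)=\min_{n\in\mathbb{Z}}|x-y-2n|$, let $\sigma$ be the left shift on $\mathcal{S}^{\mathbb{Z}}$, and let $$\mathcal{Z}=\left\{(x_n)_{n\in\mathbb{Z}}\in\mathcal{S}^{\mathbb{Z}}:\ \forall n\in\mathbb{Z},\ \text{either } \rho(x_{n-1},x_n)\ge \tfrac12 \text{ or } \rho(x_n,x_{n+1})\ge\tfrac12\right\}.$$ For a prime $p$ let $P_p(\mathcal{Z},\sigma)=\{x\in\mathcal{Z}:\sigma^p x=x\}$, regarded as a free $\mathbb{Z}_p$-space via $\sigma$. Then $$\lim_{p\to\infty}\mathrm{coind}_p\,P_p(\mathcal{Z},\sigma)=\infty,$$ where $p$ runs over the prime numbers.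
   Context: Let $p$ be a prime and $\mathbb{Z}_p=\mathbb{Z}/p\mathbb{Z}$. A $\mathbb{Z}_p$-space is a pair $(X,T)$ with $X$ a topological space and $T:X\to X$ a homeomorphism with $T^p=\mathrm{id}$; it is free if $Tx\ne x$ for all $x\in X$ (equivalently, since $p$ is prime, $T^ax\neq x$ for all $1\le a\le p-1$ and $x\in X$). A map $f:(X,T)\to(Y,S)$ is equivariant if $f\circ T=S\circ f$. For $n\ge 0$, a free $\mathbb{Z}_p$-space $(X,T)$ is called an $E_n\mathbb{Z}_p$-space if $X$ is an $n$-dimensional finite simplicial complex, $T$ is a simplicial map (sending each simplex affinely to a simplex), and $X$ is $(n-1)$-connected, i.e. $\pi_k(X)=0$ for $0\le k\le n-1$ (for $n=0$, the finite set $\mathbb{Z}_p$ with its translation action is considered $(-1)$-connected and is an $E_0\mathbb{Z}_p$-space). For example, the $(n+1)$-fold join $(\mathbb{Z}_p)^{*(n+1)}$ with the simultaneous $\mathbb{Z}_p$-action on each factor is an $E_n\mathbb{Z}_p$-space. Any two $E_n\mathbb{Z}_p$-spaces admit equivariant continuous maps to each other in both directions, so the following does not depend on the choice of $E_n\mathbb{Z}_p$-space. The coindex of a free $\mathbb{Z}_p$-space $(X,T)$ is $$\mathrm{coind}_p(X,T)=\max\{n\ge 0:\ \text{there is an equivariant continuous map } E_n\mathbb{Z}_p\to X\},$$ abbreviated $\mathrm{coind}_p X$, with the convention $\mathrm{coind}_p\,\emptyset=-1$. $\mathcal{S}^{\mathbb{Z}}$ carries the product topology, and $\sigma((x_k)_{k\in\mathbb{Z}})=(x_{k+1})_{k\in\mathbb{Z}}$.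 The system $(\mathcal{Z},\sigma)$ has no fixed point, so $(P_p(\mathcal{Z},\sigma),\sigma)$ is a free $\mathbb{Z}_p$-space. *)

theory Defs
  imports "HOL-Analysis.Analysis" "HOL-Computational_Algebra.Primes"
begin

section \<open>Spaces with an action of the cyclic group of order \<open>p\<close>\<close>

definition Zp_space :: "nat \<Rightarrow> 'a topology \<Rightarrow> ('a \<Rightarrow> 'a) \<Rightarrow> bool" where
  "Zp_space p X T \<longleftrightarrow>
     homeomorphic_map X X T \<and> (\<forall>x\<in>topspace X. (T ^^ p) x = x)"

definition free_Zp_space :: "nat \<Rightarrow> 'a topology \<Rightarrow> ('a \<Rightarrow> 'a) \<Rightarrow> bool" where
  "free_Zp_space p X T \<longleftrightarrow> Zp_space p X T \<and> (\<forall>x\<in>topspace X. T x \<noteq> x)"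

definition equivariant_map ::
    "'a topology \<Rightarrow> ('a \<Rightarrow> 'a) \<Rightarrow> 'b topology \<Rightarrow> ('b \<Rightarrow> 'b) \<Rightarrow> ('a \<Rightarrow> 'b) \<Rightarrow> bool" where
  "equivariant_map X T Y S f \<longleftrightarrow>
     continuous_map X Y f \<and> (\<forall>x\<in>topspace X. f (T x) = S (f x))"

section \<open>Finite simplicial complexes and their geometric realizations\<close>

definition finite_complex :: "'v set set \<Rightarrow> bool" where
  "finite_complex K \<longleftrightarrow>
     finite K \<and> (\<forall>s\<in>K. finite s \<and> s \<noteq> {}) \<and> (\<forall>s\<in>K. \<forall>t. t \<subseteq> s \<and> t \<noteq> {} \<longrightarrow> t \<in> K)"

definition has_dimension :: "'v set set \<Rightarrow> nat \<Rightarrow> bool" where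
  "has_dimension K n \<longleftrightarrow> (\<exists>s\<in>K. card s = Suc n) \<and> (\<forall>s\<in>K. card s \<le> Suc n)"

text \<open>
  A point of the polyhedron is given by its barycentric coordinates: a nonnegative function on the
  vertices whose support is a simplex and whose values add up to 1. For a finite complex the
  product topology induces the usual topology of the polyhedron.
\<close>

definition polyhedron :: "'v set set \<Rightarrow> ('v \<Rightarrow> real) set" where
  "polyhedron K =
     {a. (\<forall>v. 0 \<le> a v) \<and> {v. a v \<noteq> 0} \<in> K \<and> (\<Sum>v | a v \<noteq> 0. a v) = 1}"

definition realization :: "'v set set \<Rightarrow> ('v \<Rightarrow> real) topology" where
  "realization K = top_of_set (polyhedron K)"

text \<open>
  The displayed formula is the extension of a vertex map \<open>g\<close> that is affine on every simplex.
\<close>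

definition simplicial_map ::
    "'v set set \<Rightarrow> 'w set set \<Rightarrow> (('v \<Rightarrow> real) \<Rightarrow> ('w \<Rightarrow> real)) \<Rightarrow> bool" where
  "simplicial_map K L F \<longleftrightarrow>
     (\<exists>g. (\<forall>s\<in>K. g ` s \<in> L) \<and>
          (\<forall>a\<in>polyhedron K. F a = (\<lambda>w. \<Sum>v | a v \<noteq> 0 \<and> g v = w. a v)))"

section \<open>Homotopy groups\<close>

definition sphere_base :: "nat \<Rightarrow> real" where
  "sphere_base = (\<lambda>i. if i = 0 then 1 else 0)"

definition pointed_sphere_maps :: "nat \<Rightarrow> 'a topology \<Rightarrow> 'a \<Rightarrow> ((nat \<Rightarrow> real) \<Rightarrow> 'a) set" where
  "pointed_sphere_maps k X x0 = {f. continuous_map (nsphere k) X f \<and> f sphere_base = x0}"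

text \<open>
  The underlying set of the homotopy group (of the pointed set of path components if \<open>k = 0\<close>).
  The group structure is not needed to say that it is trivial.
\<close>

definition homotopy_group :: "nat \<Rightarrow> 'a topology \<Rightarrow> 'a \<Rightarrow> ((nat \<Rightarrow> real) \<Rightarrow> 'a) set set" where
  "homotopy_group k X x0 =
     pointed_sphere_maps k X x0 //
       {(f, g). homotopic_with (\<lambda>h. h sphere_base = x0) (nsphere k) X f g}"

definition trivial_homotopy :: "nat \<Rightarrow> 'a topology \<Rightarrow> bool" where
  "trivial_homotopy k X \<longleftrightarrow> (\<forall>x0\<in>topspace X. is_singleton (homotopy_group k X x0))"

lemma trivial_homotopy_iff:
  "trivial_homotopy k X \<longleftrightarrow>
     (\<forall>x0\<in>topspace X. \<forall>f\<in>pointed_sphere_maps k X x0.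
        homotopic_with (\<lambda>h. h sphere_base = x0) (nsphere k) X f (\<lambda>_. x0))"
proof -
  have "is_singleton (homotopy_group k X x0) \<longleftrightarrow>
          (\<forall>f\<in>pointed_sphere_maps k X x0.
             homotopic_with (\<lambda>h. h sphere_base = x0) (nsphere k) X f (\<lambda>_. x0))"
    if x0: "x0 \<in> topspace X" for x0
  proof -
    define M where "M = pointed_sphere_maps k X x0"
    define R where "R = {(f, g). homotopic_with (\<lambda>h. h sphere_base = x0) (nsphere k) X f g}"
    have c: "(\<lambda>_. x0) \<in> M"
      using x0 by (simp add: M_def pointed_sphere_maps_def)
    have sub: "R \<subseteq> M \<times> M"
      by (auto simp: R_def M_def pointed_sphere_maps_def
          dest: homotopic_with_imp_continuous_maps homotopic_with_imp_property)
    have refl: "(f, f) \<in> R" if "f \<in> M" for f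
      using that by (simp add: R_def M_def pointed_sphere_maps_def)
    have eq: "equiv M R"
      unfolding equiv_def
    proof (intro conjI)
      show "R \<subseteq> M \<times> M" by (fact sub)
      show "refl_on M R" using refl by (simp add: refl_on_def)
      show "sym R" by (auto simp: sym_def R_def homotopic_with_symD)
      show "trans R" by (auto simp: trans_def R_def intro: homotopic_with_trans)
    qed
    have "is_singleton (M // R) \<longleftrightarrow> (\<forall>f\<in>M. (f, \<lambda>_. x0) \<in> R)"
    proof
      assume "is_singleton (M // R)"
      then obtain C where C: "M // R = {C}" by (auto simp: is_singleton_def)
      show "\<forall>f\<in>M. (f, \<lambda>_. x0) \<in> R"
      proof
        fix f assume f: "f \<in> M"
        have "R `` {f} \<in> M // R" "R `` {\<lambda>_. x0} \<in> M // R"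
          using f c by (auto intro: quotientI)
        then have "R `` {f} = R `` {\<lambda>_. x0}" using C by auto
        then show "(f, \<lambda>_. x0) \<in> R" using eq_equiv_class[OF _ eq c] by blast
      qed
    next
      assume r: "\<forall>f\<in>M. (f, \<lambda>_. x0) \<in> R"
      have "M // R = {R `` {\<lambda>_. x0}}"
      proof
        show "M // R \<subseteq> {R `` {\<lambda>_. x0}}"
          using r equiv_class_eq[OF eq] by (fastforce elim!: quotientE)
        show "{R `` {\<lambda>_. x0}} \<subseteq> M // R" using c by (auto intro: quotientI)
      qed
      then show "is_singleton (M // R)" by (simp add: is_singleton_def)
    qed
    then show ?thesis by (simp add: homotopy_group_def M_def R_def)
  qed
  then show ?thesis by (simp add: trivial_homotopy_def)
qed

section \<open>The coindex\<close>

text \<open>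
  Every finite complex is isomorphic to one whose vertices are natural numbers. For \<open>n = 0\<close> the
  connectivity requirement is empty, and nonemptiness comes from the dimension.
\<close>

definition EZp_space ::
    "nat \<Rightarrow> nat \<Rightarrow> (nat \<Rightarrow> real) topology \<Rightarrow> ((nat \<Rightarrow> real) \<Rightarrow> (nat \<Rightarrow> real)) \<Rightarrow> bool" where
  "EZp_space p n E S \<longleftrightarrow>
     free_Zp_space p E S \<and>
     (\<exists>K. finite_complex K \<and> has_dimension K n \<and> E = realization K \<and> simplicial_map K K S) \<and>
     (\<forall>k<n. trivial_homotopy k E)"

text \<open>
  The supremum is the maximum whenever the set of admissible \<open>n\<close> is finite (and nonempty), and it
  is \<open>\<infinity>\<close> if there are admissible \<open>n\<close> of arbitrary size. The value lies in the extended reals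
  because of the convention \<open>- 1\<close> for the empty space.
\<close>

definition coind :: "nat \<Rightarrow> 'a topology \<Rightarrow> ('a \<Rightarrow> 'a) \<Rightarrow> ereal" where
  "coind p X T =
     (if topspace X = {} then - 1
      else (SUP n \<in> {n. \<exists>E S f. EZp_space p n E S \<and> equivariant_map E S X T f}. ereal (real n)))"

section \<open>The circle of length 2\<close>

definition cong_mod2 :: "real \<Rightarrow> real \<Rightarrow> bool" where
  "cong_mod2 x y \<longleftrightarrow> (\<exists>n::int. x - y = 2 * of_int n)"

lemma equivp_cong_mod2: "equivp cong_mod2"
proof (rule equivpI)
  show "reflp cong_mod2"
    by (rule reflpI) (auto simp: cong_mod2_def)
  show "symp cong_mod2"
  proof (rule sympI)
    fix x y assume "cong_mod2 x y"
    then obtain n :: int where "x - y = 2 * of_int n" by (auto simp: cong_mod2_def)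
    then have "y - x = 2 * of_int (- n)" by simp
    then show "cong_mod2 y x" unfolding cong_mod2_def by blast
  qed
  show "transp cong_mod2"
  proof (rule transpI)
    fix x y z assume "cong_mod2 x y" "cong_mod2 y z"
    then obtain m n :: int where "x - y = 2 * of_int m" "y - z = 2 * of_int n"
      by (auto simp: cong_mod2_def)
    then have "x - z = 2 * of_int (m + n)" by simp
    then show "cong_mod2 x z" unfolding cong_mod2_def by blast
  qed
qed

quotient_type circle2 = real / cong_mod2
  by (rule equivp_cong_mod2)

definition rho :: "real \<Rightarrow> real \<Rightarrow> real" where
  "rho x y = (INF n::int. \<bar>x - y - 2 * of_int n\<bar>)"

lemma rho_le: "rho x y \<le> \<bar>x - y - 2 * of_int n\<bar>"
  unfolding rho_def by (rule cINF_lower) (auto intro: bdd_belowI[where m = 0])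

lemma rho_attained: "\<exists>n::int. rho x y = \<bar>x - y - 2 * of_int n\<bar>"
proof -
  define m where "m = round ((x - y) / 2)"
  have "\<bar>x - y - 2 * of_int m\<bar> \<le> \<bar>x - y - 2 * of_int n\<bar>" for n :: int
  proof -
    have half: "\<bar>x - y - 2 * of_int k\<bar> = 2 * \<bar>(x - y) / 2 - of_int k\<bar>" for k :: int
      by (simp add: abs_if field_simps)
    show ?thesis
      using round_diff_minimal[of "(x - y) / 2" n] by (simp add: half m_def)
  qed
  then have "\<bar>x - y - 2 * of_int m\<bar> \<le> rho x y"
    unfolding rho_def by (intro cINF_greatest) auto
  with rho_le[of x y m] show ?thesis by (intro exI[of _ m]) simp
qed

lemma rho_cong_le:
  assumes "cong_mod2 x x'" "cong_mod2 y y'"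
  shows "rho x y \<le> rho x' y'"
proof -
  obtain a b :: int where ab: "x - x' = 2 * of_int a" "y - y' = 2 * of_int b"
    using assms by (auto simp: cong_mod2_def)
  obtain n :: int where n: "rho x' y' = \<bar>x' - y' - 2 * of_int n\<bar>" using rho_attained by blast
  have "x' - y' - 2 * of_int n = x - y - 2 * of_int (n + a - b)" using ab by simp
  then show ?thesis using n rho_le[of x y "n + a - b"] by simp
qed

instantiation circle2 :: metric_space
begin

lift_definition dist_circle2 :: "circle2 \<Rightarrow> circle2 \<Rightarrow> real" is rho
  by (meson antisym rho_cong_le equivp_cong_mod2 equivp_symp)

definition uniformity_circle2 :: "(circle2 \<times> circle2) filter" where
  "uniformity_circle2 = (INF e\<in>{0 <..}. principal {(x, y). dist x y < e})"

definition open_circle2 :: "circle2 set \<Rightarrow> bool" where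
  "open_circle2 U \<longleftrightarrow> (\<forall>x\<in>U. eventually (\<lambda>(x', y). x' = x \<longrightarrow> y \<in> U) uniformity)"

instance
proof
  show "uniformity = (INF e\<in>{0 <..}. principal {(x, y :: circle2). dist x y < e})"
    by (rule uniformity_circle2_def)
next
  fix U :: "circle2 set"
  show "open U \<longleftrightarrow> (\<forall>x\<in>U. eventually (\<lambda>(x', y). x' = x \<longrightarrow> y \<in> U) uniformity)"
    by (rule open_circle2_def)
next
  fix x y :: circle2
  show "dist x y = 0 \<longleftrightarrow> x = y"
  proof transfer
    fix x y :: real
    show "rho x y = 0 \<longleftrightarrow> cong_mod2 x y"
    proof
      assume "rho x y = 0"
      then obtain n :: int where "\<bar>x - y - 2 * of_int n\<bar> = 0" using rho_attained by metis
      then show "cong_mod2 x y" by (auto simp: cong_mod2_def)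
    next
      assume "cong_mod2 x y"
      then obtain n :: int where "x - y = 2 * of_int n" by (auto simp: cong_mod2_def)
      then have "rho x y \<le> 0" using rho_le[of x y n] by simp
      moreover have "0 \<le> rho x y" using rho_attained[of x y] by auto
      ultimately show "rho x y = 0" by simp
    qed
  qed
next
  fix x y z :: circle2
  show "dist x y \<le> dist x z + dist y z"
  proof transfer
    fix x y z :: real
    obtain m n :: int
      where "rho x z = \<bar>x - z - 2 * of_int m\<bar>" "rho y z = \<bar>y - z - 2 * of_int n\<bar>"
      using rho_attained by metis
    then show "rho x y \<le> rho x z + rho y z"
      using rho_le[of x y "m - n"] by simp
  qed
qed

end

section \<open>The system\<close>

text \<open>
  The function type \<open>int \<Rightarrow> circle2\<close> carries the product topology (type class instance).
\<close>

definition shift :: "(int \<Rightarrow> 'a) \<Rightarrow> (int \<Rightarrow> 'a)" where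
  "shift x = (\<lambda>k. x (k + 1))"

definition Zsys :: "(int \<Rightarrow> circle2) set" where
  "Zsys = {x. \<forall>n. dist (x (n - 1)) (x n) \<ge> 1/2 \<or> dist (x n) (x (n + 1)) \<ge> 1/2}"

definition periodic_points :: "nat \<Rightarrow> 'a set \<Rightarrow> ('a \<Rightarrow> 'a) \<Rightarrow> 'a set" where
  "periodic_points p A T = {x \<in> A. (T ^^ p) x = x}"

lemma free_Zp_space_periodic_points:
  "free_Zp_space p (top_of_set (periodic_points p Zsys shift)) shift"
proof -
  let ?P = "periodic_points p Zsys shift"
  define unshift :: "(int \<Rightarrow> circle2) \<Rightarrow> (int \<Rightarrow> circle2)" where "unshift x = (\<lambda>k. x (k - 1))" for x
  have inv: "shift (unshift x) = x" "unshift (shift x) = x" for x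
    by (simp_all add: shift_def unshift_def)
  have comm: "(shift ^^ p) (shift x) = shift ((shift ^^ p) x)" for x :: "int \<Rightarrow> circle2"
    by (simp add: funpow_swap1)
  have comm': "(shift ^^ p) (unshift x) = unshift ((shift ^^ p) x)" for x
    by (metis comm inv)
  have Z1: "shift x \<in> Zsys" if x: "x \<in> Zsys" for x
    unfolding Zsys_def
  proof safe
    fix n
    assume "\<not> 1/2 \<le> dist (shift x n) (shift x (n + 1))"
    then show "1/2 \<le> dist (shift x (n - 1)) (shift x n)"
      using x[unfolded Zsys_def, simplified, rule_format, of "n + 1"] by (simp add: shift_def)
  qed
  have Z2: "unshift x \<in> Zsys" if x: "x \<in> Zsys" for x
    unfolding Zsys_def
  proof safe
    fix n
    assume "\<not> 1/2 \<le> dist (unshift x n) (unshift x (n + 1))"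
    then show "1/2 \<le> dist (unshift x (n - 1)) (unshift x n)"
      using x[unfolded Zsys_def, simplified, rule_format, of "n - 1"] by (simp add: unshift_def)
  qed
  have c1: "continuous_on ?P shift" and c2: "continuous_on ?P unshift"
    unfolding shift_def unshift_def
    by (intro continuous_on_coordinatewise_then_product
        continuous_on_subset[OF continuous_on_product_coordinates]; simp)+
  have "shift ` ?P \<subseteq> ?P" "unshift ` ?P \<subseteq> ?P"
    using Z1 Z2 by (auto simp: periodic_points_def comm comm')
  then have "homeomorphic_maps (top_of_set ?P) (top_of_set ?P) shift unshift"
    using c1 c2 inv by (auto simp: homeomorphic_maps_def continuous_map_subtopology_eu)
  then have "homeomorphic_map (top_of_set ?P) (top_of_set ?P) shift"
    by (rule homeomorphic_maps_map[THEN iffD1, THEN conjunct1])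
  moreover have "shift x \<noteq> x" if "x \<in> ?P" for x
  proof
    assume e: "shift x = x"
    have step: "x (k + 1) = x k" for k using fun_cong[OF e, of k] by (simp add: shift_def)
    have "x (0 - 1) = x 0" using step[of "-1"] by simp
    moreover have "x (0 + 1) = x 0" by (rule step)
    ultimately show False using that by (auto simp: periodic_points_def Zsys_def dest: spec[of _ 0])
  qed
  ultimately show ?thesis
    by (auto simp: free_Zp_space_def Zp_space_def periodic_points_def)
qed

end

theory Submission
  imports Defs
begin

text \<open>
  A real sequence that satisfies \<open>x\<^sub>k = x\<^bsub>k+1\<^esub> + 1\<close> except at isolated places \<open>k\<close> reduces
  modulo 2 to a point of the system. Hence a free \<open>p\<close>-periodic space maps equivariantly to the
  periodic points as soon as it carries a continuous function which on every orbit has a strict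
  local maximum: strict local maxima are never adjacent, and one may reset the sequence to 0 there.

  For the source take the join of \<open>m\<close> cycles of length \<open>p\<close>, a sphere of dimension \<open>2 m - 1\<close>, on
  which the generator acts by turning every cycle almost by a half turn. The function is the maximum
  of the barycentric coordinates at finitely many vertices, placed on the cycles according to a Sidon
  set (the powers of 4) so that they interfere with each other too rarely to spoil all the maxima
  along an orbit, provided that \<open>p\<close> is large compared to \<open>m\<close>.

  That the join is highly connected reduces to contracting maps of a low-dimensional sphere into a
  punctured Euclidean space, by Lipschitz approximation and counting grid points.
\<close>

section \<open>Equivariant maps to the periodic points\<close>

lemma dist_abs_circle2: "dist (abs_circle2 x) (abs_circle2 y) = rho x y"
  by (rule dist_circle2.abs_eq)

lemma dist_abs_circle2_le: "dist (abs_circle2 x) (abs_circle2 y) \<le> \<bar>x - y\<bar>"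
  using rho_le[of x y 0] by (simp add: dist_abs_circle2)

lemma continuous_on_abs_circle2: "continuous_on A abs_circle2"
  unfolding continuous_on_iff
  using dist_abs_circle2_le by (metis dist_real_def order_le_less_trans)

text \<open>An odd integer has absolute value at least 1, so no choice of representatives brings the
  two points closer: they are antipodal.\<close>

lemma dist_abs_circle2_add_1: "dist (abs_circle2 (x + 1)) (abs_circle2 x) = 1"
proof -
  obtain n :: int where n: "rho (x + 1) x = \<bar>(x + 1) - x - 2 * of_int n\<bar>"
    using rho_attained by blast
  have "\<bar>1 - 2 * n\<bar> \<ge> 1" by presburger
  then have "\<bar>1 - 2 * real_of_int n\<bar> \<ge> 1" by linarith
  then show ?thesis
    using n dist_abs_circle2_le[of "x + 1" x] by (simp add: dist_abs_circle2)
qed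

lemma funpow_in: "S ` X \<subseteq> X \<Longrightarrow> a \<in> X \<Longrightarrow> (S ^^ j) a \<in> X"
  by (induction j) auto

lemma continuous_on_funpow:
  "continuous_on X S \<Longrightarrow> S ` X \<subseteq> X \<Longrightarrow> continuous_on X (S ^^ j)"
proof (induction j)
  case (Suc j)
  then have "continuous_on ((S ^^ j) ` X) S"
    by (auto intro: continuous_on_subset dest: funpow_in)
  then have "continuous_on X (S \<circ> (S ^^ j))" using Suc by (intro continuous_on_compose) auto
  then show ?case by simp
qed (simp add: id_def)

lemma funpow_mod_period:
  assumes "S ` X \<subseteq> X" "\<And>a. a \<in> X \<Longrightarrow> (S ^^ p) a = a" "a \<in> X"
  shows "(S ^^ (j mod p)) a = (S ^^ j) a"
proof -
  have mult: "(S ^^ (p * q)) b = b" if "b \<in> X" for q b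
    by (induction q) (simp_all add: funpow_add assms(2) that)
  have "(S ^^ j) a = (S ^^ (j mod p + p * (j div p))) a" by simp
  also have "\<dots> = (S ^^ (j mod p)) a"
    by (simp only: funpow_add comp_apply mult[OF assms(3)])
  finally show ?thesis by simp
qed

lemma Suc_nat_mod_int:
  assumes "0 < p"
  shows "Suc (nat (k mod int p)) mod p = nat ((k + 1) mod int p)"
proof -
  have "int (Suc (nat (k mod int p)) mod p) = (k + 1) mod int p"
    using assms by (simp add: zmod_int mod_simps add.commute)
  then show ?thesis by (metis nat_int)
qed

text \<open>
  Where the marker \<open>w\<close> vanishes the real sequence \<open>G\<close> moves by exactly 1; where \<open>w\<close> equals 1 it
  forgets its past, which makes it well defined along a periodic orbit.
\<close>

lemma equivariant_map_from_marker:
  fixes X :: "'a::topological_space set" and w :: "'a \<Rightarrow> real"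
  assumes p: "0 < p" and S: "continuous_on X S" "S ` X \<subseteq> X"
    and per: "\<And>a. a \<in> X \<Longrightarrow> (S ^^ p) a = a"
    and w: "continuous_on X w" "\<And>a. a \<in> X \<Longrightarrow> w a = 0 \<or> w (S a) = 0"
    and hit: "\<And>a. a \<in> X \<Longrightarrow> \<exists>j. w ((S ^^ j) a) = 1"
  shows "\<exists>f. equivariant_map (top_of_set X) S (top_of_set (periodic_points p Zsys shift)) shift f"
proof -
  \<comment> \<open>\<open>G\<close> is a continuous version of the number of steps to the next
    point with \<open>w = 1\<close>: it is exactly that number when \<open>w\<close> takes only the
    values 0 and 1.\<close>
  define D where "D t a = (\<Prod>j\<le>t. 1 - w ((S ^^ j) a))" for t a
  define G where "G a = (\<Sum>t<p. D t a)" for a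
  define f where "f a = (\<lambda>k::int. abs_circle2 (G ((S ^^ nat (k mod int p)) a)))" for a
  \<comment> \<open>By periodicity the first \<open>p\<close> iterates include one with
    \<open>w = 1\<close>, so cutting the sum \<open>G\<close> at \<open>p\<close> loses
    nothing.\<close>
  have D0: "D t a = 0" if "a \<in> X" "p \<le> Suc t" for a t
  proof -
    obtain j where "w ((S ^^ j) a) = 1" using hit \<open>a \<in> X\<close> by blast
    then have "w ((S ^^ (j mod p)) a) = 1"
      using funpow_mod_period[OF S(2) per \<open>a \<in> X\<close>] by simp
    moreover have "j mod p \<le> t" using p that(2) by (metis Suc_leI le_trans mod_less_divisor not_less_eq_eq)
    ultimately show ?thesis unfolding D_def by (intro prod_zero) force+
  qed
  have DS: "(1 - w a) * D t (S a) = D (Suc t) a" for t a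
    unfolding D_def by (simp only: prod.atMost_Suc_shift) (simp add: funpow_swap1)
  have G: "G a = (1 - w a) * (G (S a) + 1)" if a: "a \<in> X" for a
  proof -
    have "(1 - w a) * (G (S a) + 1) = (\<Sum>t<p. D (Suc t) a) + D 0 a"
      by (simp add: G_def distrib_left sum_distrib_left DS) (simp add: D_def)
    also have "\<dots> = (\<Sum>t<Suc p. D t a)" by (simp only: sum.lessThan_Suc_shift add.commute)
    also have "\<dots> = G a" using D0[OF a, of p] by (simp add: G_def)
    finally show ?thesis by simp
  qed
  have step: "dist (abs_circle2 (G a)) (abs_circle2 (G (S a))) = 1" if "a \<in> X" "w a = 0" for a
    using G[OF that(1)] that(2) dist_abs_circle2_add_1[of "G (S a)"] by simp
  have cG: "continuous_on X G"
    unfolding G_def D_def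
    by (intro continuous_intros continuous_on_compose2[OF w(1)] continuous_on_funpow S)
      (auto intro: funpow_in[OF S(2)])
  have cf: "continuous_on X f"
    unfolding f_def
    by (intro continuous_on_coordinatewise_then_product
        continuous_on_compose2[OF continuous_on_abs_circle2[of UNIV]]
        continuous_on_compose2[OF cG] continuous_on_funpow S) (auto intro: funpow_in[OF S(2)])
  have nxt: "(S ^^ nat ((k + 1) mod int p)) a = S ((S ^^ nat (k mod int p)) a)"
    if "a \<in> X" for a k
    using funpow_mod_period[OF S(2) per that, of "Suc (nat (k mod int p))"]
    by (simp add: Suc_nat_mod_int[OF p])
  have fS: "f (S a) = shift (f a)" if "a \<in> X" for a
    using nxt[OF that] by (simp add: f_def shift_def funpow_swap1)
  have "f a \<in> Zsys" if a: "a \<in> X" for a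
    unfolding Zsys_def
  proof safe
    fix n
    \<comment> \<open>From position \<open>n - 1\<close> on: at least one of \<open>b\<close>,
      \<open>S b\<close> has marker 0, and the step that starts there has length 1.\<close>
    define b where "b = (S ^^ nat ((n - 1) mod int p)) a"
    have b: "b \<in> X" "S b \<in> X" using a S(2) by (auto simp: b_def intro: funpow_in)
    have "f a (n - 1) = abs_circle2 (G b)" by (simp add: f_def b_def)
    moreover have "f a n = abs_circle2 (G (S b))"
      using nxt[OF a, of "n - 1"] by (simp add: f_def b_def)
    moreover have "f a (n + 1) = abs_circle2 (G (S (S b)))"
      using nxt[OF a, of "n - 1"] nxt[OF a, of n] by (simp add: f_def b_def)
    moreover assume "\<not> 1/2 \<le> dist (f a n) (f a (n + 1))"
    ultimately show "1/2 \<le> dist (f a (n - 1)) (f a n)"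
      using w(2)[OF b(1)] step[OF b(1)] step[OF b(2)] by auto
  qed
  moreover have "(shift ^^ j) x = (\<lambda>k. x (k + int j))" for j and x :: "int \<Rightarrow> circle2"
    by (induction j) (auto simp: shift_def fun_eq_iff algebra_simps)
  then have "(shift ^^ p) (f a) = f a" for a by (simp add: f_def)
  ultimately have "f ` X \<subseteq> periodic_points p Zsys shift" by (auto simp: periodic_points_def)
  then show ?thesis
    using cf fS by (auto simp: equivariant_map_def continuous_map_subtopology_eu intro!: exI[of _ f])
qed

text \<open>\<open>W a\<close> measures how far \<open>F\<close> at the middle point
  \<open>S a\<close> exceeds both neighbours. Dividing by its mean over the orbit and capping at 1
  gives a marker: some value is at least the mean and so becomes 1.\<close>

lemma equivariant_map_from_local_maxima:
  fixes X :: "'a::topological_space set" and F :: "'a \<Rightarrow> real"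
  assumes p: "0 < p" and S: "continuous_on X S" "S ` X \<subseteq> X"
    and per: "\<And>a. a \<in> X \<Longrightarrow> (S ^^ p) a = a"
    and F: "continuous_on X F"
    and peak: "\<And>a. a \<in> X \<Longrightarrow> \<exists>k. F ((S ^^ k) a) < F ((S ^^ Suc k) a) \<and>
                 F ((S ^^ Suc (Suc k)) a) < F ((S ^^ Suc k) a)"
  shows "\<exists>f. equivariant_map (top_of_set X) S (top_of_set (periodic_points p Zsys shift)) shift f"
proof -
  define W where "W a = max 0 (F (S a) - max (F a) (F (S (S a))))" for a
  define V where "V a = (\<Sum>j<p. W ((S ^^ j) a))" for a
  define w where "w a = min 1 (real p * W a / V a)" for a
  have W0: "0 \<le> W a" for a by (simp add: W_def)
  have Wper: "W ((S ^^ (j mod p)) a) = W ((S ^^ j) a)" if "a \<in> X" for a j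
    using funpow_mod_period[OF S(2) per that] by simp
  have V: "0 < V a" if a: "a \<in> X" for a
  proof -
    obtain k where "0 < W ((S ^^ k) a)"
      using peak[OF a] by (auto simp: W_def less_max_iff_disj)
    then have "0 < W ((S ^^ (k mod p)) a)" by (simp add: Wper[OF a])
    then show ?thesis
      unfolding V_def using p W0 by (intro sum_pos2[of _ "k mod p"]) auto
  qed
  have VS: "V (S a) = V a" if a: "a \<in> X" for a
  proof -
    have "V (S a) + W a = (\<Sum>j<Suc p. W ((S ^^ j) a))"
      unfolding V_def by (simp only: sum.lessThan_Suc_shift) (simp add: funpow_swap1)
    also have "\<dots> = V a + W a" using per[OF a] by (simp add: V_def)
    finally show ?thesis by simp
  qed
  have Vj: "V ((S ^^ j) a) = V a" if a: "a \<in> X" for a j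
    by (induction j) (simp_all add: VS funpow_in[OF S(2) a])
  have cS: "continuous_on X (\<lambda>a. F (S a))" "continuous_on X (\<lambda>a. F (S (S a)))"
    using S by (auto intro!: continuous_on_compose2[OF F] continuous_on_compose2[OF S(1)])
  have cW: "continuous_on X W"
    unfolding W_def by (intro continuous_intros cS F)
  have cV: "continuous_on X V"
    unfolding V_def
    by (intro continuous_intros continuous_on_compose2[OF cW] continuous_on_funpow S)
      (auto intro: funpow_in[OF S(2)])
  have cw: "continuous_on X w"
    unfolding w_def
    by (intro continuous_intros cW cV) (use V in force)
  have sparse: "w a = 0 \<or> w (S a) = 0" if "a \<in> X" for a
  proof -
    \<comment> \<open>A positive \<open>W a\<close> needs \<open>F (S a)\<close> above
      \<open>F (S (S a))\<close>, a positive \<open>W (S a)\<close> the reverse.\<close>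
    have "W a = 0 \<or> W (S a) = 0" by (auto simp: W_def max_def)
    then show ?thesis by (auto simp: w_def)
  qed
  have hit: "\<exists>j. w ((S ^^ j) a) = 1" if a: "a \<in> X" for a
  proof (rule ccontr)
    assume no: "\<nexists>j. w ((S ^^ j) a) = 1"
    have "real p * W ((S ^^ j) a) < V a" for j
    proof -
      have "w ((S ^^ j) a) \<le> 1" by (simp add: w_def)
      then have "w ((S ^^ j) a) < 1" using no by (metis order_le_less)
      then show ?thesis using V[OF a] by (simp add: w_def Vj[OF a] min_less_iff_disj divide_less_eq_1_pos)
    qed
    then have "(\<Sum>j<p. real p * W ((S ^^ j) a)) < (\<Sum>j<p. V a)"
      using p by (intro sum_strict_mono) auto
    then show False using p by (simp add: V_def flip: sum_distrib_left)
  qed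
  show ?thesis
    by (rule equivariant_map_from_marker[OF p S per cw sparse hit])
qed

section \<open>Joins of cycles\<close>

definition rot :: "nat \<Rightarrow> nat \<Rightarrow> nat \<Rightarrow> nat" where
  "rot p c v = v div p * p + (v mod p + c) mod p"

text \<open>
  The join of \<open>m\<close> cycles with \<open>p\<close> vertices each: the vertex \<open>h\<close> of the \<open>i\<close>-th cycle is the number
  \<open>i * p + h\<close>, and a simplex meets every cycle in a subset of an edge.
\<close>

definition cycle_join :: "nat \<Rightarrow> nat \<Rightarrow> nat set set" where
  "cycle_join p m = {s. s \<noteq> {} \<and> s \<subseteq> {..<m * p} \<and>
     (\<exists>h. \<forall>v\<in>s. v mod p = h (v div p) mod p \<or> v mod p = Suc (h (v div p)) mod p)}"

text \<open>
  Precomposing with \<open>rot p ((p - 1) div 2)\<close> moves the supports by \<open>(p + 1) / 2\<close>. This is nearly half a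
  turn, so that a point and its image have disjoint supports.
\<close>

definition turn :: "nat \<Rightarrow> (nat \<Rightarrow> real) \<Rightarrow> nat \<Rightarrow> real" where
  "turn p a = a \<circ> rot p ((p - 1) div 2)"

section \<open>Rotations of the vertices and the simplices of the join\<close>

lemma rot_div: "0 < p \<Longrightarrow> rot p c v div p = v div p"
  and rot_mod: "0 < p \<Longrightarrow> rot p c v mod p = (v mod p + c) mod p"
  by (simp_all add: rot_def)

lemma rot_rot: "0 < p \<Longrightarrow> rot p c (rot p d v) = rot p (c + d) v"
  by (simp add: rot_def mod_add_left_eq add.assoc add.commute[of c])

lemma rot_multiple: "rot p (p * q) v = v" and rot_0: "rot p 0 v = v"
  by (simp_all add: rot_def)

lemma rot_less_iff: "0 < p \<Longrightarrow> rot p c v < m * p \<longleftrightarrow> v < m * p"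
  by (simp add: rot_div flip: div_less_iff_less_mult)

lemma turn_funpow: "0 < p \<Longrightarrow> (turn p ^^ k) a = a \<circ> rot p (k * ((p - 1) div 2))"
  by (induction k) (simp_all add: turn_def fun_eq_iff rot_0 rot_rot add.commute)

lemma cycle_join_subset:
  assumes s: "s \<in> cycle_join p m" and t: "t \<subseteq> s" "t \<noteq> {}"
  shows "t \<in> cycle_join p m"
proof -
  obtain h where "s \<subseteq> {..<m * p}"
    and h: "\<And>v. v \<in> s \<Longrightarrow> v mod p = h (v div p) mod p \<or> v mod p = Suc (h (v div p)) mod p"
    using s by (auto simp: cycle_join_def)
  then have "t \<subseteq> {..<m * p}" using t by blast
  moreover have "\<forall>v\<in>t. v mod p = h (v div p) mod p \<or> v mod p = Suc (h (v div p)) mod p"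
    using h t by blast
  ultimately show ?thesis using t by (auto simp: cycle_join_def)
qed

lemma finite_complex_cycle_join: "finite_complex (cycle_join p m)"
proof -
  have "cycle_join p m \<subseteq> Pow {..<m * p}" by (auto simp: cycle_join_def)
  then have "finite (cycle_join p m)" by (rule finite_subset) simp
  moreover have "finite s \<and> s \<noteq> {}" if "s \<in> cycle_join p m" for s
  proof -
    have "s \<subseteq> {..<m * p}" "s \<noteq> {}" using that by (simp_all add: cycle_join_def)
    then show ?thesis using finite_subset by blast
  qed
  ultimately show ?thesis unfolding finite_complex_def using cycle_join_subset by blast
qed

text \<open>A simplex lies in a union of \<open>m\<close> edges, one on each cycle.\<close>

lemma card_cycle_join_le:
  assumes "s \<in> cycle_join p m"
  shows "card s \<le> 2 * m"
proof -
  obtain h where s: "s \<subseteq> {..<m * p}"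
    and h: "\<And>v. v \<in> s \<Longrightarrow> v mod p = h (v div p) mod p \<or> v mod p = Suc (h (v div p)) mod p"
    using assms by (auto simp: cycle_join_def)
  have "s \<subseteq> (\<lambda>(i, e). i * p + (h i + e) mod p) ` ({..<m} \<times> {0, 1})"
  proof
    fix v assume v: "v \<in> s"
    then have "v div p < m" using s by (auto simp: less_mult_imp_div_less)
    moreover obtain e where "e \<in> {0, 1}" "v mod p = (h (v div p) + e) mod p"
      using h[OF v] by (metis add.right_neutral Suc_eq_plus1 insertI1 insertI2)
    ultimately show "v \<in> (\<lambda>(i, e). i * p + (h i + e) mod p) ` ({..<m} \<times> {0, 1})"
      using div_mult_mod_eq[of v p] by (intro image_eqI[of _ _ "(v div p, e)"]) auto
  qed
  then have "card s \<le> card ({..<m} \<times> {0, 1::nat})" by (rule surj_card_le[rotated]) simp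
  then show ?thesis by simp
qed

lemma has_dimension_cycle_join:
  assumes "2 \<le> p" "0 < m"
  shows "has_dimension (cycle_join p m) (2 * m - 1)"
proof -
  \<comment> \<open>The vertices 0 and 1 of every cycle together span a simplex of the largest
    size.\<close>
  define s where "s = (\<lambda>(i, e). i * p + e) ` ({..<m} \<times> {0, 1::nat})"
  have e: "(i * p + e) div p = i" "(i * p + e) mod p = e" if "e \<in> {0, 1}" for i e
    using that assms by auto
  have "s \<in> cycle_join p m"
    unfolding cycle_join_def
  proof (safe intro!: exI[of _ "\<lambda>_. 0"])
    assume "s = {}" then show False using assms by (simp add: s_def lessThan_empty_iff)
  next
    fix v assume "v \<in> s"
    then obtain i e' where v: "v = i * p + e'" "i < m" "e' \<in> {0, 1}" by (auto simp: s_def)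
    have "v div p < m" using v e by simp
    then show "v < m * p" using assms by (simp add: div_less_iff_less_mult)
    assume "v mod p \<noteq> Suc 0 mod p"
    then show "v mod p = 0 mod p" using v e[of e' i] assms by auto
  qed
  moreover have "inj_on (\<lambda>(i, e). i * p + e) ({..<m} \<times> {0, 1})"
    by (rule inj_onI) (use e in \<open>metis (no_types, lifting) case_prodE SigmaD2 case_prod_conv mem_Sigma_iff surj_pair\<close>)
  then have "card s = 2 * m" by (simp add: s_def card_image)
  ultimately show ?thesis
    using card_cycle_join_le assms unfolding has_dimension_def by (intro conjI bexI[of _ s]) fastforce+
qed

lemma rot_cycle_join:
  assumes p: "0 < p" and s: "s \<in> cycle_join p m"
  shows "rot p c ` s \<in> cycle_join p m"
proof -
  obtain h where h: "\<And>v. v \<in> s \<Longrightarrow> v mod p = h (v div p) mod p \<or> v mod p = Suc (h (v div p)) mod p"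
    using s by (auto simp: cycle_join_def)
  have "w mod p = (h (w div p) + c) mod p \<or> w mod p = Suc (h (w div p) + c) mod p"
    if w: "w \<in> rot p c ` s" for w
  proof -
    obtain v where v: "v \<in> s" "w = rot p c v" using w by auto
    have "w mod p = (v mod p + c) mod p" "w div p = v div p"
      using p v by (simp_all add: rot_mod rot_div)
    then show ?thesis using h[OF v(1)] by (metis mod_add_left_eq add_Suc)
  qed
  then show ?thesis
    using s p by (auto simp: cycle_join_def rot_less_iff intro!: exI[of _ "\<lambda>i. h i + c"])
qed

section \<open>Points of the polyhedron in barycentric coordinates\<close>

lemma polyhedron_cycle_joinD:
  assumes "a \<in> polyhedron (cycle_join p m)"
  shows "0 \<le> a v" "a v \<noteq> 0 \<Longrightarrow> v < m * p" "(\<Sum>v<m * p. a v) = 1"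
    and "\<exists>h. \<forall>v. a v \<noteq> 0 \<longrightarrow> v mod p = h (v div p) mod p \<or> v mod p = Suc (h (v div p)) mod p"
proof -
  have K: "{v. a v \<noteq> 0} \<in> cycle_join p m" using assms by (simp add: polyhedron_def)
  then have sub: "{v. a v \<noteq> 0} \<subseteq> {..<m * p}" by (simp add: cycle_join_def)
  have "(\<Sum>v<m * p. a v) = (\<Sum>v | a v \<noteq> 0. a v)"
    using sub by (intro sum.mono_neutral_right) auto
  then show "(\<Sum>v<m * p. a v) = 1" using assms by (simp add: polyhedron_def)
  show "0 \<le> a v" using assms by (simp add: polyhedron_def)
  show "v < m * p" if "a v \<noteq> 0" using sub that by auto
  show "\<exists>h. \<forall>v. a v \<noteq> 0 \<longrightarrow> v mod p = h (v div p) mod p \<or> v mod p = Suc (h (v div p)) mod p"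
    using K by (auto simp: cycle_join_def)
qed

lemma polyhedron_cycle_joinI:
  assumes "\<And>v. 0 \<le> a v" "\<And>v. a v \<noteq> 0 \<Longrightarrow> v < m * p" "(\<Sum>v<m * p. a v) = 1"
    and "\<And>v. a v \<noteq> 0 \<Longrightarrow> v mod p = h (v div p) mod p \<or> v mod p = Suc (h (v div p)) mod p"
  shows "a \<in> polyhedron (cycle_join p m)"
proof -
  have sub: "{v. a v \<noteq> 0} \<subseteq> {..<m * p}" using assms(2) by auto
  then have sum: "(\<Sum>v | a v \<noteq> 0. a v) = 1"
    unfolding assms(3)[symmetric] by (intro sum.mono_neutral_left) auto
  then have "{v. a v \<noteq> 0} \<noteq> {}" by force
  then show ?thesis
    using assms(1,4) sub sum by (auto simp: polyhedron_def cycle_join_def)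
qed

text \<open>Both vertices lie on the one edge that the support selects on their cycle. Divisibility
  over the integers absorbs the wrap-around and can be added to the congruences that describe a
  rotation.\<close>

lemma adjacent_vertices:
  assumes a: "a \<in> polyhedron (cycle_join p m)" and uv: "a u \<noteq> 0" "a v \<noteq> 0" "u div p = v div p"
  shows "\<exists>e\<in>{-1, 0, 1}. int p dvd int (u mod p) - int (v mod p) - e"
proof -
  obtain h where h: "\<And>v. a v \<noteq> 0 \<Longrightarrow> v mod p = h (v div p) mod p \<or> v mod p = Suc (h (v div p)) mod p"
    using polyhedron_cycle_joinD(4)[OF a] by blast
  define g where "g = int (h (v div p))"
  have d: "int p dvd int (w mod p) - g \<or> int p dvd int (w mod p) - (g + 1)" if "w = u \<or> w = v" for w
  proof -
    have "int (w mod p) = g mod int p \<or> int (w mod p) = (g + 1) mod int p"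
      using h[of w] that uv unfolding g_def by (metis of_nat_Suc of_nat_mod add.commute)
    then show ?thesis by (metis dvd_minus_mod minus_diff_eq dvd_minus_iff)
  qed
  have diff: "int p dvd int (u mod p) - int (v mod p) - (s - t)"
    if "int p dvd int (u mod p) - (g + s)" "int p dvd int (v mod p) - (g + t)" for s t
    using dvd_diff[OF that] by (simp add: algebra_simps)
  from d[OF disjI1[OF refl]] d[OF disjI2[OF refl]] show ?thesis
    using diff[of 0 0] diff[of 0 1] diff[of 1 0] diff[of 1 1] by auto
qed

lemma rot_polyhedron:
  assumes p: "0 < p" and a: "a \<in> polyhedron (cycle_join p m)"
  shows "a \<circ> rot p c \<in> polyhedron (cycle_join p m)"
proof -
  \<comment> \<open>The inverse rotation: a natural number congruent to \<open>- c\<close> modulo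
    \<open>p\<close>.\<close>
  define c' where "c' = p * c - c"
  have inv: "rot p c (rot p c' v) = v" "rot p c' (rot p c v) = v" for v
    using p rot_multiple[of p c v] by (simp_all add: rot_rot c'_def le_add_diff_inverse)
  then have supp: "{v. (a \<circ> rot p c) v \<noteq> 0} = rot p c' ` {v. a v \<noteq> 0}"
    by (force simp: image_iff)
  have "(\<Sum>v | (a \<circ> rot p c) v \<noteq> 0. (a \<circ> rot p c) v) = (\<Sum>v | a v \<noteq> 0. a v)"
    by (rule sum.reindex_bij_witness[of _ "rot p c'" "rot p c"]) (auto simp: inv)
  then show ?thesis
    using a rot_cycle_join[OF p, of "{v. a v \<noteq> 0}" m c'] supp by (auto simp: polyhedron_def)
qed

section \<open>The turn as a free simplicial action\<close>

lemma turn_polyhedron: "0 < p \<Longrightarrow> turn p ` polyhedron (cycle_join p m) \<subseteq> polyhedron (cycle_join p m)"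
  by (rule image_subsetI) (simp add: turn_def rot_polyhedron)

lemma continuous_on_comp: "continuous_on X (\<lambda>a::nat \<Rightarrow> real. a \<circ> r)"
  unfolding comp_def
  by (intro continuous_on_coordinatewise_then_product continuous_on_subset[OF continuous_on_product_coordinates]) simp

lemma continuous_on_turn: "continuous_on X (turn p)"
  using continuous_on_comp[of X "rot p ((p - 1) div 2)"] by (simp add: turn_def[abs_def])

lemma turn_period: "0 < p \<Longrightarrow> (turn p ^^ p) a = a"
  by (simp add: turn_funpow fun_eq_iff rot_multiple)

text \<open>With \<open>p = 2 * n + 1\<close>, the support of a fixed point contains a vertex
  together with its rotation by \<open>n\<close>, so \<open>n\<close> is congruent to -1, 0 or 1
  modulo \<open>p\<close>. This is impossible for \<open>n\<close> at least 2.\<close>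

lemma turn_neq:
  assumes p: "odd p" "5 \<le> p" and a: "a \<in> polyhedron (cycle_join p m)"
  shows "turn p a \<noteq> a"
proof
  assume fixed: "turn p a = a"
  obtain n where n: "p = 2 * n + 1" using p by (elim oddE)
  obtain v where v: "a v \<noteq> 0" using polyhedron_cycle_joinD(3)[OF a] by force
  have "a (rot p n v) = a v" using fun_cong[OF fixed, of v] n by (simp add: turn_def)
  then obtain e where e: "e \<in> {-1, 0, 1}" "int p dvd int (rot p n v mod p) - int (v mod p) - e"
    using adjacent_vertices[OF a, of "rot p n v" v] v p rot_div[of p n v] by fastforce
  have "int p dvd (int (v mod p) + int n) - int (rot p n v mod p)"
    using n by (simp only: rot_mod zero_less_Suc Suc_eq_plus1[symmetric] of_nat_mod of_nat_add dvd_minus_mod)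
  then have "int p dvd ((int (v mod p) + int n) - int (rot p n v mod p)) + (int (rot p n v mod p) - int (v mod p) - e)"
    using e(2) by (rule dvd_add)
  then have "int p dvd int n - e" by simp
  moreover have "0 < int n - e" "int n - e < int p" using e(1) n p by auto
  ultimately show False by (auto dest: zdvd_imp_le)
qed

lemma free_Zp_space_turn:
  assumes p: "odd p" "5 \<le> p"
  shows "free_Zp_space p (realization (cycle_join p m)) (turn p)"
proof -
  define P where "P = polyhedron (cycle_join p m)"
  have p0: "0 < p" using p by simp
  \<comment> \<open>The inverse of the turn is its \<open>(p - 1)\<close>-st iterate.\<close>
  define unturn where "unturn a = a \<circ> rot p ((p - 1) * ((p - 1) div 2))" for a :: "nat \<Rightarrow> real"
  have inv: "unturn (turn p a) = a" "turn p (unturn a) = a" for a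
    using p0 rot_multiple[of p "(p - 1) div 2"]
    by (auto simp: fun_eq_iff unturn_def turn_def rot_rot diff_mult_distrib)
  have "homeomorphic_maps (top_of_set P) (top_of_set P) (turn p) unturn"
    using turn_polyhedron[OF p0] continuous_on_turn rot_polyhedron[OF p0] inv
      continuous_on_comp[of P "rot p ((p - 1) * ((p - 1) div 2))"]
    by (auto simp: homeomorphic_maps_def continuous_map_subtopology_eu P_def unturn_def[abs_def])
  then have "homeomorphic_map (top_of_set P) (top_of_set P) (turn p)"
    by (rule homeomorphic_maps_map[THEN iffD1, THEN conjunct1])
  then show ?thesis
    using turn_period[OF p0] turn_neq[OF p]
    by (auto simp: free_Zp_space_def Zp_space_def realization_def P_def)
qed

lemma simplicial_map_turn:
  assumes p: "0 < p"
  shows "simplicial_map (cycle_join p m) (cycle_join p m) (turn p)"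
proof -
  define c where "c = (p - 1) div 2"
  \<comment> \<open>Precomposition moves supports backwards, so the vertex map is the inverse
    rotation.\<close>
  define g where "g = rot p (p * c - c)"
  have inv: "rot p c (g v) = v" "g (rot p c v) = v" for v
    using p rot_multiple[of p c v] by (simp_all add: rot_rot g_def)
  have "turn p a = (\<lambda>w. \<Sum>v | a v \<noteq> 0 \<and> g v = w. a v)" for a
  proof
    fix w
    have "{v. a v \<noteq> 0 \<and> g v = w} = (if a (rot p c w) = 0 then {} else {rot p c w})"
      using inv by auto
    then show "turn p a w = (\<Sum>v | a v \<noteq> 0 \<and> g v = w. a v)" by (simp add: turn_def c_def)
  qed
  then show ?thesis
    unfolding simplicial_map_def using rot_cycle_join[OF p] by (intro exI[of _ g]) (auto simp: g_def)
qed

section \<open>Strict local maxima along orbits\<close>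

text \<open>The sum determines its larger exponent: if \<open>c\<close> and \<open>d\<close> are
  both below \<open>max a b\<close>, then \<open>4 ^ c + 4 ^ d\<close> is at most half of
  \<open>4 ^ max a b\<close>. The remaining powers then cancel.\<close>

lemma power4_sidon:
  fixes a b c d :: nat
  assumes eq: "(4::nat) ^ a + 4 ^ b = 4 ^ c + 4 ^ d"
  shows "a = c \<and> b = d \<or> a = d \<and> b = c"
proof -
  have max: "max a b \<le> max c d" if "(4::nat) ^ a + 4 ^ b = 4 ^ c + 4 ^ d" for a b c d :: nat
  proof (rule ccontr)
    assume "\<not> max a b \<le> max c d"
    then have "Suc c \<le> max a b" "Suc d \<le> max a b" by auto
    then have "(4::nat) ^ Suc c \<le> 4 ^ max a b" "(4::nat) ^ Suc d \<le> 4 ^ max a b"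
      by (intro power_increasing; simp)+
    moreover have "(4::nat) ^ max a b \<le> 4 ^ a + 4 ^ b" by (simp add: max_def)
    moreover have "(0::nat) < 4 ^ c" by simp
    ultimately show False using that by simp
  qed
  have "max a b = max c d" by (rule antisym[OF max[OF eq] max[OF eq[symmetric]]])
  then consider "a = c" | "a = d" | "b = c" | "b = d" by (auto simp: max_def split: if_splits)
  then show ?thesis using eq by cases auto
qed

text \<open>The index \<open>x\<close> selects both the cycle and the exponent, so no power of 4 is
  reused on another cycle. Each cycle gets \<open>4 * m + 1\<close> vertices, one more than the
  number of pairs of a neighbouring time and a vertex of a simplex.\<close>

definition height :: "nat \<Rightarrow> nat \<Rightarrow> (nat \<Rightarrow> real) \<Rightarrow> real" where
  "height p m a = (MAX x\<in>{..<m * (4 * m + 1)}. a (x div (4 * m + 1) * p + 4 ^ x))"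

lemma continuous_on_height: "0 < m \<Longrightarrow> continuous_on X (height p m)"
proof -
  assume "0 < m"
  have "continuous_on X (\<lambda>a. MAX x\<in>A. a (f x))" if "finite A" "A \<noteq> {}" for A :: "nat set" and f :: "nat \<Rightarrow> nat"
    using that
  proof (induction rule: finite_ne_induct)
    case (insert x F)
    have "(\<lambda>a::nat \<Rightarrow> real. MAX x\<in>insert x F. a (f x)) = (\<lambda>a. max (a (f x)) (MAX x\<in>F. a (f x)))"
      using insert by simp
    then show ?case
      using insert by (auto intro!: continuous_intros continuous_on_subset[OF continuous_on_product_coordinates])
  qed (auto intro: continuous_on_subset[OF continuous_on_product_coordinates])
  then show ?thesis unfolding height_def[abs_def] using \<open>0 < m\<close> by (simp add: lessThan_empty_iff)
qed

text \<open>
  The largest barycentric coordinate of \<open>a\<close> is attained at some vertex \<open>v0\<close>. Its cycle contains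
  \<open>4 * m + 1\<close> of the vertices read by the height, so there are that many times at which the height
  of the orbit takes its largest value. Were none of them a strict local maximum, two of the
  coincidences would involve the same vertex, contradicting the Sidon property of the powers of 4.
\<close>

lemma height_peak:
  assumes p: "odd p" "5 \<le> p" "2 * 4 ^ (m * (4 * m + 1)) \<le> p"
    and a: "a \<in> polyhedron (cycle_join p m)"
  shows "\<exists>k. height p m ((turn p ^^ k) a) < height p m ((turn p ^^ Suc k) a) \<and>
             height p m ((turn p ^^ Suc (Suc k)) a) < height p m ((turn p ^^ Suc k) a)"
proof -
  define N where "N = 4 * m + 1"
  obtain n where n: "p = 2 * n + 1" using p(1) by (elim oddE)
  define P where "P = int p"
  have p0: "0 < p" and n2: "2 \<le> n" and Pn: "P = 2 * int n + 1" using p n by (simp_all add: P_def)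
  have small: "2 * 4 ^ x < p" if "x < m * N" for x
  proof -
    have "(4::nat) ^ x < 4 ^ (m * N)" using that by simp
    then show ?thesis using p(3) unfolding N_def by linarith
  qed
  have small1: "4 ^ x < p" if "x < m * N" for x using small[OF that] by simp
  note aD = polyhedron_cycle_joinD[OF a]
  define supp where "supp = {v. a v \<noteq> 0}"
  have "supp \<in> cycle_join p m" using a by (simp add: supp_def polyhedron_def)
  then have supp: "finite supp" "card supp \<le> 2 * m"
    using card_cycle_join_le by (auto simp: cycle_join_def intro: finite_subset)
  have "\<exists>v. a v \<noteq> 0" by (rule ccontr) (use aD(3) in simp)
  then have mp: "{..<m * p} \<noteq> {}" using aD(2) by force
  define \<alpha> where "\<alpha> = Max (a ` {..<m * p})"
  have "\<alpha> \<in> a ` {..<m * p}" unfolding \<alpha>_def using mp by (intro Max_in) auto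
  then obtain v0 where v0: "v0 < m * p" "a v0 = \<alpha>" by auto
  have le: "a v \<le> \<alpha>" for v
  proof (cases "v < m * p")
    case True then show ?thesis by (simp add: \<alpha>_def)
  next
    case False
    then have "a v = 0" using aD(2) by blast
    then show ?thesis using aD(1)[of v0] v0 by simp
  qed
  have pos: "0 < \<alpha>"
  proof (rule ccontr)
    assume "\<not> 0 < \<alpha>"
    then have "a v = 0" for v using le[of v] aD(1)[of v] by simp
    then show False using \<open>\<exists>v. a v \<noteq> 0\<close> by blast
  qed
  define i where "i = v0 div p"
  define h where "h = v0 mod p"
  have i: "i < m" and h: "h < p" using v0 p0 by (simp_all add: i_def h_def less_mult_imp_div_less)
  have orbit: "height p m ((turn p ^^ k) a) = (MAX x\<in>{..<m * N}. a (x div N * p + (4 ^ x + k * n) mod p))" for k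
  proof -
    have "rot p (k * n) (x div N * p + 4 ^ x) = x div N * p + (4 ^ x + k * n) mod p" if "x < m * N" for x
      using small1[OF that] by (simp add: rot_def)
    moreover have "(p - 1) div 2 = n" using n by simp
    ultimately show ?thesis
      unfolding height_def N_def[symmetric]
      by (intro arg_cong[of _ _ Max] image_cong) (simp_all add: turn_funpow p0)
  qed
  have mN: "{..<m * N} \<noteq> {}" using i by (simp add: N_def lessThan_empty_iff)
  define X where "X c = i * N + c" for c
  \<comment> \<open>As \<open>2 * n\<close> is congruent to -1, the even time \<open>2 * s\<close>
    moves the reading position \<open>4 ^ X c\<close> to \<open>4 ^ X c - s\<close> modulo
    \<open>p\<close>. Taking \<open>s = 4 ^ X c + (p - h)\<close> makes it \<open>h\<close>, so
    \<open>v0\<close> is read at time \<open>Suc (K c)\<close>.\<close>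
  define K where "K c = 2 * 4 ^ X c + 2 * (p - h) - 1" for c
  have K: "Suc (K c) = 2 * 4 ^ X c + 2 * (p - h)" for c
    using h by (simp add: K_def)
  have X: "X c < m * N" "X c div N = i" if "c < N" for c
  proof -
    show "X c div N = i" using that by (simp add: X_def)
    moreover have "0 < N" using that by simp
    ultimately show "X c < m * N" using i by (simp add: flip: div_less_iff_less_mult)
  qed
  have top: "height p m ((turn p ^^ Suc (K c)) a) = \<alpha>" if c: "c < N" for c
    unfolding orbit
  proof (rule Max_eqI)
    have "int (4 ^ X c + Suc (K c) * n) = 4 ^ X c + (2 * 4 ^ X c + 2 * (P - int h)) * int n"
      using h by (simp add: K P_def of_nat_diff)
    also have "\<dots> = int h + P * (4 ^ X c + (P - int h) - 1)"
      unfolding Pn by (simp add: algebra_simps)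
    finally have "int ((4 ^ X c + Suc (K c) * n) mod p) = int h"
      using h by (simp add: zmod_int P_def)
    then have "(4 ^ X c + Suc (K c) * n) mod p = h" by simp
    then have "\<alpha> = a (X c div N * p + (4 ^ X c + Suc (K c) * n) mod p)"
      using X(2)[OF c] v0(2) by (simp add: i_def h_def)
    then show "\<alpha> \<in> (\<lambda>x. a (x div N * p + (4 ^ x + Suc (K c) * n) mod p)) ` {..<m * N}"
      using X(1)[OF c] by blast
  qed (auto intro: le)
  show ?thesis
  proof (rule ccontr)
    assume no: "\<not> ?thesis"
    \<comment> \<open>If time \<open>Suc (K c)\<close> is no strict maximum, the height is again
      \<alpha> just before (\<open>\<sigma> = 0\<close>) or just after
      (\<open>\<sigma> = 2\<close>), read through some index \<open>x\<close>.\<close>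
    have "\<exists>\<sigma> x. \<sigma> \<in> {0, 2} \<and> x < m * N \<and> a (x div N * p + (4 ^ x + (K c + \<sigma>) * n) mod p) = \<alpha>"
      if c: "c < N" for c
    proof -
      obtain \<sigma> where \<sigma>: "\<sigma> \<in> {0, 2}" "\<alpha> \<le> height p m ((turn p ^^ (K c + \<sigma>)) a)"
        using no top[OF c] by (metis insertI1 insertI2 add_0_right add_2_eq_Suc' not_less)
      have "height p m ((turn p ^^ (K c + \<sigma>)) a) \<in>
          (\<lambda>x. a (x div N * p + (4 ^ x + (K c + \<sigma>) * n) mod p)) ` {..<m * N}"
        unfolding orbit using mN by (intro Max_in) auto
      then obtain x where "x < m * N" "height p m ((turn p ^^ (K c + \<sigma>)) a) =
          a (x div N * p + (4 ^ x + (K c + \<sigma>) * n) mod p)" by auto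
      then show ?thesis using \<sigma> le by (metis order_antisym)
    qed
    then obtain \<sigma> x where \<sigma>x: "\<And>c. c < N \<Longrightarrow> \<sigma> c \<in> {0, 2::nat} \<and> x c < m * N \<and>
        a (x c div N * p + (4 ^ x c + (K c + \<sigma> c) * n) mod p) = \<alpha>"
      by metis
    define u where "u c = x c div N * p + (4 ^ x c + (K c + \<sigma> c) * n) mod p" for c
    have u: "u c \<in> supp" "u c div p = x c div N" "u c mod p = (4 ^ x c + (K c + \<sigma> c) * n) mod p"
      if "c < N" for c
      using \<sigma>x[OF that] pos p0 by (simp_all add: u_def supp_def)
    \<comment> \<open>Pigeonhole: \<open>4 * m + 1\<close> values of \<open>c\<close>, but at most
      \<open>2 * (2 * m)\<close> pairs.\<close>
    have "(\<lambda>c. (\<sigma> c, u c)) ` {..<N} \<subseteq> {0, 2} \<times> supp"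
    proof (rule image_subsetI)
      fix c assume "c \<in> {..<N}"
      then have "c < N" by simp
      then show "(\<sigma> c, u c) \<in> {0, 2} \<times> supp" using \<sigma>x[of c] u(1)[of c] by blast
    qed
    then have "card ((\<lambda>c. (\<sigma> c, u c)) ` {..<N}) \<le> card ({0, 2::nat} \<times> supp)"
      using supp by (intro card_mono) auto
    also have "\<dots> < card {..<N}" using supp by (simp add: N_def)
    finally have "\<not> inj_on (\<lambda>c. (\<sigma> c, u c)) {..<N}" by (rule pigeonhole)
    then obtain c c' where c: "c < N" "c' < N" "c \<noteq> c'" "\<sigma> c = \<sigma> c'" "u c = u c'"
      by (auto simp: inj_on_def)
    have modeq: "P dvd int (4 ^ x c + (K c + \<sigma> c) * n) - int (u c mod p)" if "c < N" for c
      unfolding u(3)[OF that] P_def by (simp only: of_nat_mod dvd_minus_mod)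
    have Kint: "int (K c) = 2 * 4 ^ X c + 2 * (P - int h) - 1" for c
    proof -
      have "int (Suc (K c)) = 2 * 4 ^ X c + 2 * (P - int h)"
        unfolding K using h by (simp add: P_def of_nat_diff)
      then show ?thesis by simp
    qed
    have "P dvd int (4 ^ x c + (K c + \<sigma> c) * n) - int (4 ^ x c' + (K c' + \<sigma> c') * n)"
    proof -
      have "(A - w) - (B - w) = A - B" for A B w :: int by simp
      then show ?thesis using dvd_diff[OF modeq[OF c(1)] modeq[OF c(2)]] unfolding c(5) by (simp only:)
    qed
    \<comment> \<open>The common \<sigma> and \<open>h\<close> cancel, and
      \<open>2 * n = P - 1\<close> leaves only powers of 4 modulo \<open>P\<close>.\<close>
    also have "int (4 ^ x c + (K c + \<sigma> c) * n) - int (4 ^ x c' + (K c' + \<sigma> c') * n) =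
        (4 ^ x c + 4 ^ X c' - (4 ^ x c' + 4 ^ X c)) + P * (4 ^ X c - 4 ^ X c')"
      unfolding Pn c(4) by (simp add: Kint algebra_simps)
    finally have "P dvd 4 ^ x c + 4 ^ X c' - (4 ^ x c' + 4 ^ X c)"
      by (simp add: dvd_add_left_iff)
    \<comment> \<open>Each power is below \<open>P / 2\<close>, so the congruence of the two sums is
      an equality.\<close>
    moreover have "\<bar>4 ^ x c + 4 ^ X c' - (4 ^ x c' + 4 ^ X c)\<bar> < P"
    proof -
      have b: "2 * 4 ^ y < P" "0 < (4::int) ^ y" if "y < m * N" for y
        using small[OF that] unfolding P_def by (simp_all flip: of_nat_less_iff[where 'a = int])
      show ?thesis
        using b[OF X(1)[OF c(1)]] b[OF X(1)[OF c(2)]] b[of "x c"] b[of "x c'"] \<sigma>x[OF c(1)] \<sigma>x[OF c(2)]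
        unfolding abs_less_iff by linarith
    qed
    ultimately have "4 ^ x c + 4 ^ X c' = (4 ^ x c' + 4 ^ X c :: int)"
      using dvd_imp_le_int[of "4 ^ x c + 4 ^ X c' - (4 ^ x c' + 4 ^ X c)" P] by fastforce
    then have "int (4 ^ x c + 4 ^ X c') = int (4 ^ x c' + 4 ^ X c)" by simp
    then have "4 ^ x c + 4 ^ X c' = (4 ^ x c' + 4 ^ X c :: nat)" by (simp only: of_nat_eq_iff)
    \<comment> \<open>The other pairing would give \<open>X c = X c'\<close>, against
      \<open>c \<noteq> c'\<close>.\<close>
    then have xX: "x c = X c" using power4_sidon[of "x c" "X c'" "x c'" "X c"] c(3) by (auto simp: X_def)
    have "u c div p = v0 div p" using u(2)[OF c(1)] X(2)[OF c(1)] xX by (simp add: i_def)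
    moreover have "a (u c) \<noteq> 0" "a v0 \<noteq> 0" using u(1)[OF c(1)] v0(2) pos by (auto simp: supp_def)
    ultimately obtain e where e: "e \<in> {-1, 0, 1}" "P dvd int (u c mod p) - int h - e"
      using adjacent_vertices[OF a, of "u c" v0] unfolding P_def h_def by blast
    \<comment> \<open>The same index read one time step away from \<open>h\<close> sits at
      \<open>h\<close> plus or minus \<open>n\<close>, which is too far from \<open>v0\<close> for
      both vertices to lie on one edge.\<close>
    have "P dvd (int (4 ^ x c + (K c + \<sigma> c) * n) - int (u c mod p)) + (int (u c mod p) - int h - e)"
      using modeq[OF c(1)] e(2) by (rule dvd_add)
    also have "\<dots> = (int (\<sigma> c) - 1) * int n - e + P * (4 ^ X c + (P - int h) - 1)"
      unfolding xX by (simp add: Kint Pn algebra_simps)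
    finally have "P dvd (int (\<sigma> c) - 1) * int n - e" by (simp add: dvd_add_left_iff)
    moreover have "int (\<sigma> c) - 1 = 1 \<or> int (\<sigma> c) - 1 = -1" using \<sigma>x[OF c(1)] by auto
    then have "(int (\<sigma> c) - 1) * int n - e \<noteq> 0" "\<bar>(int (\<sigma> c) - 1) * int n - e\<bar> < P"
      using e(1) n2 Pn by auto
    ultimately show False by (metis dvd_imp_le_int abs_ge_self order_le_less_trans not_less)
  qed
qed

section \<open>Maps from spheres to punctured Euclidean spaces\<close>

definition cube :: "nat \<Rightarrow> (nat \<Rightarrow> real) set" where
  "cube k = {y. \<forall>i\<le>k. \<bar>y i\<bar> \<le> 1}"

definition ell1 :: "nat \<Rightarrow> (nat \<Rightarrow> real) \<Rightarrow> (nat \<Rightarrow> real) \<Rightarrow> real" where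
  "ell1 k y z = (\<Sum>i\<le>k. \<bar>y i - z i\<bar>)"

text \<open>As \<open>ell1 k\<close> ignores the coordinates beyond \<open>k\<close>, such a
  function depends on the cube only on the first \<open>k + 1\<close> of them. The cube replaces the
  sphere because it contains the segments along which the sphere is later contracted.\<close>

definition lip_cube :: "nat \<Rightarrow> ((nat \<Rightarrow> real) \<Rightarrow> real) \<Rightarrow> real \<Rightarrow> bool" where
  "lip_cube k g L \<longleftrightarrow> (\<forall>y\<in>cube k. \<forall>z\<in>cube k. \<bar>g y - g z\<bar> \<le> L * ell1 k y z)"

definition unit_sphere :: "nat \<Rightarrow> (nat \<Rightarrow> real) set" where
  "unit_sphere k = {x. (\<Sum>i\<le>k. (x i)\<^sup>2) = 1 \<and> (\<forall>i>k. x i = 0)}"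

lemma nsphere_eq: "nsphere k = top_of_set (unit_sphere k)"
  by (simp add: nsphere unit_sphere_def euclidean_product_topology)

lemma unit_sphere_subset_cube: "unit_sphere k \<subseteq> cube k"
proof
  fix x assume x: "x \<in> unit_sphere k"
  have "\<bar>x i\<bar> \<le> 1" if "i \<le> k" for i
  proof -
    have "(x i)\<^sup>2 \<le> (\<Sum>i\<le>k. (x i)\<^sup>2)" using that by (intro member_le_sum) auto
    then show ?thesis using x by (simp add: unit_sphere_def power_le_one_iff abs_square_le_1)
  qed
  then show "x \<in> cube k" by (simp add: cube_def)
qed

text \<open>A closed subset of a product of compact intervals, by Tychonoff.\<close>

lemma compact_unit_sphere: "compact (unit_sphere k)"
proof -
  have "compactin (product_topology (\<lambda>i::nat. euclideanreal) UNIV) (\<Pi>\<^sub>E i\<in>UNIV. {-1..1})"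
    by (subst compactin_PiE) simp
  then have c: "compact (\<Pi>\<^sub>E i\<in>(UNIV::nat set). {-1..1::real})"
    by (simp add: euclidean_product_topology)
  have coord: "closed {x::nat \<Rightarrow> real. x i = 0}" for i
    by (intro closed_Collect_eq continuous_intros continuous_on_product_coordinates)
  have "closed ({x::nat \<Rightarrow> real. (\<Sum>i\<le>k. (x i)\<^sup>2) = 1} \<inter> (\<Inter>i\<in>{k<..}. {x. x i = 0}))"
    by (intro closed_Int closed_INT ballI coord closed_Collect_eq continuous_intros
        continuous_on_product_coordinates)
  moreover have "{x::nat \<Rightarrow> real. (\<Sum>i\<le>k. (x i)\<^sup>2) = 1} \<inter> (\<Inter>i\<in>{k<..}. {x. x i = 0}) = unit_sphere k"
    by (auto simp: unit_sphere_def)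
  ultimately have cl: "closed (unit_sphere k)" by simp
  have "unit_sphere k \<subseteq> (\<Pi>\<^sub>E i\<in>UNIV. {-1..1})"
  proof
    fix x assume x: "x \<in> unit_sphere k"
    have "\<bar>x i\<bar> \<le> 1" for i
      using x unit_sphere_subset_cube[of k] by (cases "i \<le> k") (auto simp: cube_def unit_sphere_def)
    then show "x \<in> (\<Pi>\<^sub>E i\<in>UNIV. {-1..1})" by (auto simp: abs_le_iff minus_le_iff)
  qed
  then show ?thesis using compact_Int_closed[OF c cl] by (simp add: inf.absorb2)
qed

lemma ell1_nonneg: "0 \<le> ell1 k y z" and ell1_commute: "ell1 k y z = ell1 k z y"
  by (simp_all add: ell1_def sum_nonneg abs_minus_commute)

lemma ell1_triangle: "\<bar>ell1 k y b - ell1 k z b\<bar> \<le> ell1 k y z"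
proof -
  have "\<bar>ell1 k y b - ell1 k z b\<bar> = \<bar>\<Sum>i\<le>k. \<bar>y i - b i\<bar> - \<bar>z i - b i\<bar>\<bar>"
    by (simp add: ell1_def sum_subtractf)
  also have "\<dots> \<le> (\<Sum>i\<le>k. \<bar>\<bar>y i - b i\<bar> - \<bar>z i - b i\<bar>\<bar>)" by (rule sum_abs)
  also have "\<dots> \<le> ell1 k y z" unfolding ell1_def by (intro sum_mono) linarith
  finally show ?thesis .
qed

lemma ell1_le_cube: "y \<in> cube k \<Longrightarrow> z \<in> cube k \<Longrightarrow> ell1 k y z \<le> 2 * (real k + 1)"
proof -
  assume "y \<in> cube k" "z \<in> cube k"
  then have "\<bar>y i - z i\<bar> \<le> 2" if "i \<le> k" for i
    using that by (force simp: cube_def dest!: spec[of _ i])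
  then have "ell1 k y z \<le> (\<Sum>i\<le>k. 2)" unfolding ell1_def by (intro sum_mono) auto
  then show ?thesis by simp
qed

lemma lip_cube_mono: "lip_cube k g L \<Longrightarrow> L \<le> L' \<Longrightarrow> lip_cube k g L'"
  unfolding lip_cube_def by (meson ell1_nonneg mult_right_mono order_trans)

lemma lip_cube_bounded:
  assumes "lip_cube k g L" obtains B where "0 \<le> B" "\<And>y. y \<in> cube k \<Longrightarrow> \<bar>g y\<bar> \<le> B"
proof
  define B where "B = \<bar>g (\<lambda>_. 0)\<bar> + \<bar>L\<bar> * (2 * (real k + 1))"
  show "0 \<le> B" by (simp add: B_def)
  fix y assume y: "y \<in> cube k"
  have z: "(\<lambda>_. 0) \<in> cube k" by (simp add: cube_def)
  have "L * ell1 k y (\<lambda>_. 0) \<le> \<bar>L\<bar> * (2 * (real k + 1))"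
    using ell1_le_cube[OF y z] ell1_nonneg[of k y "\<lambda>_. 0"]
    by (meson abs_ge_self abs_ge_zero mult_mono)
  then show "\<bar>g y\<bar> \<le> B" using assms y z unfolding lip_cube_def B_def by fastforce
qed

lemma lip_cube_mult:
  assumes f: "lip_cube k f L" and g: "lip_cube k g M"
  shows "\<exists>N. lip_cube k (\<lambda>x. f x * g x) N"
proof -
  obtain A where A: "0 \<le> A" "\<And>y. y \<in> cube k \<Longrightarrow> \<bar>f y\<bar> \<le> A" using lip_cube_bounded[OF f] by metis
  obtain B where B: "0 \<le> B" "\<And>y. y \<in> cube k \<Longrightarrow> \<bar>g y\<bar> \<le> B" using lip_cube_bounded[OF g] by metis
  have "lip_cube k (\<lambda>x. f x * g x) (A * \<bar>M\<bar> + \<bar>L\<bar> * B)"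
    unfolding lip_cube_def
  proof (intro ballI)
    fix y z assume yz: "y \<in> cube k" "z \<in> cube k"
    let ?D = "ell1 k y z"
    have D: "0 \<le> ?D" by (rule ell1_nonneg)
    have 1: "\<bar>g y - g z\<bar> \<le> \<bar>M\<bar> * ?D" and 2: "\<bar>f y - f z\<bar> \<le> \<bar>L\<bar> * ?D"
      using lip_cube_mono[OF g, of "\<bar>M\<bar>"] lip_cube_mono[OF f, of "\<bar>L\<bar>"] yz by (auto simp: lip_cube_def)
    have "f y * g y - f z * g z = f y * (g y - g z) + (f y - f z) * g z" by (simp add: algebra_simps)
    also have "\<bar>\<dots>\<bar> \<le> \<bar>f y\<bar> * \<bar>g y - g z\<bar> + \<bar>f y - f z\<bar> * \<bar>g z\<bar>"
      by (metis abs_mult abs_triangle_ineq)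
    also have "\<dots> \<le> A * (\<bar>M\<bar> * ?D) + (\<bar>L\<bar> * ?D) * B"
      using 1 2 A B yz D by (intro add_mono mult_mono) auto
    finally show "\<bar>f y * g y - f z * g z\<bar> \<le> (A * \<bar>M\<bar> + \<bar>L\<bar> * B) * ?D"
      by (simp add: algebra_simps)
  qed
  then show ?thesis by blast
qed

text \<open>Stone-Weierstrass for the algebra of continuous functions that are Lipschitz on the
  cube; the coordinates separate points. The approximant, unlike \<open>f\<close>, is controlled off
  the sphere as well.\<close>

lemma lipschitz_approximation:
  assumes f: "continuous_on (unit_sphere k) f" and e: "0 < e"
  shows "\<exists>g L. continuous_on UNIV g \<and> lip_cube k g L \<and> (\<forall>x\<in>unit_sphere k. \<bar>f x - g x\<bar> < e)"
proof -
  define P where "P g \<longleftrightarrow> continuous_on UNIV g \<and> (\<exists>L. lip_cube k g L)" for g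
  have "\<exists>g. P g \<and> (\<forall>x\<in>unit_sphere k. \<bar>f x - g x\<bar> < e)"
  proof (rule Stone_Weierstrass_HOL[OF compact_unit_sphere _ _ _ _ _ f e])
    fix c :: real show "P (\<lambda>_. c)"
      by (auto simp: P_def lip_cube_def intro!: exI[of _ 0])
  next
    fix g assume "P g" then show "continuous_on (unit_sphere k) g"
      by (auto simp: P_def intro: continuous_on_subset)
  next
    fix g h assume gh: "P g \<and> P h"
    then obtain L M where LM: "lip_cube k g L" "lip_cube k h M" by (auto simp: P_def)
    have "lip_cube k (\<lambda>x. g x + h x) (L + M)"
      unfolding lip_cube_def
    proof (intro ballI)
      fix y z assume "y \<in> cube k" "z \<in> cube k"
      then have "\<bar>g y - g z\<bar> \<le> L * ell1 k y z" "\<bar>h y - h z\<bar> \<le> M * ell1 k y z"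
        using LM by (auto simp: lip_cube_def)
      then show "\<bar>g y + h y - (g z + h z)\<bar> \<le> (L + M) * ell1 k y z"
        by (simp add: algebra_simps)
    qed
    then show "P (\<lambda>x. g x + h x)" using gh by (auto simp: P_def intro: continuous_intros)
    show "P (\<lambda>x. g x * h x)"
      using gh lip_cube_mult[OF LM] by (auto simp: P_def intro: continuous_intros)
  next
    fix x y assume xy: "x \<in> unit_sphere k \<and> y \<in> unit_sphere k \<and> x \<noteq> y"
    then obtain i where i: "x i \<noteq> y i" by auto
    then have "i \<le> k" using xy by (force simp: unit_sphere_def not_le)
    then have "lip_cube k (\<lambda>x. x i) 1"
      unfolding lip_cube_def ell1_def by (auto intro: member_le_sum[of i "{..k}" "\<lambda>i. \<bar>_ i - _ i\<bar>"])
    then have "P (\<lambda>x. x i)" by (auto simp: P_def intro: continuous_on_product_coordinates)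
    then show "\<exists>f. P f \<and> f x \<noteq> f y" using i by blast
  qed
  then show ?thesis by (auto simp: P_def)
qed

text \<open>
  Each bad \<open>v\<close> is determined, in a Lipschitz manner, by a zero \<open>y\<close> in a cube of dimension
  \<open>k + 1 < d\<close>; cutting the cube into small pieces shows that the bad \<open>v\<close> cannot include every point
  of a fine grid in dimension \<open>d\<close>.
\<close>

lemma perturb_to_avoid_zero:
  fixes g :: "nat \<Rightarrow> (nat \<Rightarrow> real) \<Rightarrow> real"
  assumes kd: "k + 1 < d" and L: "0 \<le> L" "\<And>j. j < d \<Longrightarrow> lip_cube k (g j) L"
    and q: "lip_cube k q 1" and pos: "0 < \<kappa>" "0 < \<eta>"
  shows "\<exists>v. (\<forall>j. 0 \<le> v j \<and> v j \<le> \<eta>) \<and>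
             (\<forall>y\<in>cube k. \<kappa> \<le> q y \<longrightarrow> (\<exists>j<d. g j y + v j * q y \<noteq> 0))"
proof (rule ccontr)
  assume no: "\<not> ?thesis"
  \<comment> \<open>\<open>C\<close> is the ratio by which the pieces of the cube, of side
    \<open>1 / M\<close>, are refined against the number \<open>T\<close> of grid steps. It is so
    large that zeros in one piece belong to parameters less than one step \<open>\<eta> / T\<close>
    apart, while \<open>T\<close> beats the \<open>(3 * C) ^ (k + 1)\<close> lost in the
    count.\<close>
  obtain C where C: "(L + \<eta>) * (real k + 1) / (\<kappa> * \<eta>) < real C" "0 < C"
    by (metis reals_Archimedean2 gr0I less_trans of_nat_0 of_nat_1 of_nat_less_iff zero_less_one
        not_less_iff_gr_or_eq)
  define T where "T = (3 * C) ^ (k + 1) + 1"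
  define M where "M = T * C"
  define v where "v t j = (if j < d then \<eta> * real (t j) / real T else 0)" for t :: "nat \<Rightarrow> nat" and j
  define grid where "grid = ({..<d} \<rightarrow>\<^sub>E {..<T})"
  have T: "0 < T" by (simp add: T_def)
  have M: "0 < M" using T C by (simp add: M_def)
  have vb: "0 \<le> v t j \<and> v t j \<le> \<eta>" if "t \<in> grid" for t j
  proof (cases "j < d")
    case True
    then have "real (t j) \<le> real T" using that by (force simp: grid_def PiE_iff)
    then show ?thesis using T pos True by (simp add: v_def divide_simps mult_left_mono)
  qed (use pos in \<open>simp add: v_def\<close>)
  have "\<forall>t\<in>grid. \<exists>y\<in>cube k. \<kappa> \<le> q y \<and> (\<forall>j<d. g j y + v t j * q y = 0)"
    using no vb by meson
  then obtain Y where Y: "\<And>t. t \<in> grid \<Longrightarrow> Y t \<in> cube k \<and> \<kappa> \<le> q (Y t) \<and>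
      (\<forall>j<d. g j (Y t) + v t j * q (Y t) = 0)" by metis
  \<comment> \<open>The piece of the cube that contains the zero \<open>Y t\<close>.\<close>
  define label where "label t = (\<lambda>i\<in>{..k}. \<lfloor>real M * Y t i\<rfloor>)" for t
  have "label ` grid \<subseteq> {..k} \<rightarrow>\<^sub>E {- int M..int M}"
  proof (rule image_subsetI)
    fix t assume "t \<in> grid"
    then have "\<bar>Y t i\<bar> \<le> 1" if "i \<le> k" for i using Y that by (auto simp: cube_def)
    then have "real M * Y t i \<le> real M * 1 \<and> real M * (-1) \<le> real M * Y t i" if "i \<le> k" for i
      using that by (intro conjI mult_left_mono) (auto simp: abs_le_iff minus_le_iff)
    then have "\<lfloor>real M * Y t i\<rfloor> \<in> {- int M..int M}" if "i \<le> k" for i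
      using that by (force simp: floor_le_iff le_floor_iff)
    then show "label t \<in> {..k} \<rightarrow>\<^sub>E {- int M..int M}"
      unfolding label_def by auto
  qed
  moreover have "inj_on label grid"
  proof (rule inj_onI, rule ccontr)
    fix t s assume ts: "t \<in> grid" "s \<in> grid" "label t = label s" "t \<noteq> s"
    then obtain j where j: "j < d" "t j \<noteq> s j"
      by (metis grid_def PiE_ext lessThan_iff)
    have "\<bar>Y t i - Y s i\<bar> \<le> 1 / real M" if "i \<le> k" for i
    proof -
      have "\<lfloor>real M * Y t i\<rfloor> = \<lfloor>real M * Y s i\<rfloor>"
        using fun_cong[OF ts(3), of i] that by (simp add: label_def)
      then have "\<bar>real M * Y t i - real M * Y s i\<bar> \<le> 1" by linarith
      then have "real M * \<bar>Y t i - Y s i\<bar> \<le> 1" by (simp add: abs_mult flip: right_diff_distrib)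
      then show ?thesis using M by (simp add: field_simps)
    qed
    then have "ell1 k (Y t) (Y s) \<le> (\<Sum>i\<le>k. 1 / real M)" unfolding ell1_def by (intro sum_mono) auto
    then have D: "ell1 k (Y t) (Y s) \<le> (real k + 1) / real M" by (simp add: add.commute)
    have eq: "g j (Y t) + v t j * q (Y t) = 0" "g j (Y s) + v s j * q (Y s) = 0"
      using Y ts j by auto
    have "1 \<le> \<bar>real (t j) - real (s j)\<bar>" using j(2) by linarith
    then have "\<eta> / real T * 1 \<le> \<eta> / real T * \<bar>real (t j) - real (s j)\<bar>"
      using pos T by (intro mult_left_mono) auto
    also have "\<dots> = \<bar>v t j - v s j\<bar>"
      using pos T j by (simp add: v_def abs_mult flip: right_diff_distrib diff_divide_distrib)
    finally have "\<eta> / real T * \<kappa> \<le> \<bar>v t j - v s j\<bar> * q (Y t)"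
      using Y[OF ts(1)] pos T by (intro mult_mono) auto
    also have "\<dots> = \<bar>(v t j - v s j) * q (Y t)\<bar>" using Y[OF ts(1)] pos by (simp add: abs_mult)
    \<comment> \<open>Subtracting the two zero equations bounds the gap of the parameters by the
      distance of the zeros.\<close>
    also have "(v t j - v s j) * q (Y t) = (g j (Y s) - g j (Y t)) + v s j * (q (Y s) - q (Y t))"
      using eq by (simp add: algebra_simps)
    also have "\<bar>\<dots>\<bar> \<le> \<bar>g j (Y s) - g j (Y t)\<bar> + v s j * \<bar>q (Y s) - q (Y t)\<bar>"
      using abs_triangle_ineq[of "g j (Y s) - g j (Y t)" "v s j * (q (Y s) - q (Y t))"] vb[OF ts(2), of j]
      by (simp add: abs_mult)
    also have "\<dots> \<le> L * ell1 k (Y t) (Y s) + \<eta> * ell1 k (Y t) (Y s)"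
      using L(2)[OF j(1)] q Y ts vb[OF ts(2), of j] pos
      by (intro add_mono mult_mono) (auto simp: lip_cube_def ell1_commute)
    also have "\<dots> \<le> (L + \<eta>) * ((real k + 1) / real M)"
      unfolding distrib_right[symmetric] using D L pos by (intro mult_left_mono) auto
    finally have "\<eta> * \<kappa> * real C \<le> (L + \<eta>) * (real k + 1)"
      using T C M by (simp add: M_def field_simps)
    then show False using C(1) pos by (simp add: field_simps)
  qed
  ultimately have "card grid \<le> card ({..k} \<rightarrow>\<^sub>E {- int M..int M})"
    by (intro card_inj_on_le) (auto intro: finite_PiE)
  moreover have "card grid = T ^ d" by (simp add: grid_def card_PiE)
  moreover have "card {- int M..int M} = 2 * M + 1" by simp
  then have "card ({..k} \<rightarrow>\<^sub>E {- int M..int M}) = (2 * M + 1) ^ (k + 1)"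
    by (simp only: card_PiE finite_atMost prod_constant card_atMost Suc_eq_plus1)
  ultimately have "T ^ d \<le> (2 * M + 1) ^ (k + 1)" by (simp only:)
  also have "\<dots> \<le> (3 * M) ^ (k + 1)" using M by (intro power_mono) auto
  also have "\<dots> = (3 * C) ^ (k + 1) * T ^ (k + 1)" by (simp add: M_def power_mult_distrib mult_ac)
  also have "\<dots> < T * T ^ (k + 1)" using T by (intro mult_strict_right_mono) (auto simp: T_def)
  also have "\<dots> = T ^ (k + 2)" by simp
  also have "\<dots> \<le> T ^ d" using kd T by (intro power_increasing) auto
  finally show False by simp
qed

section \<open>Nullhomotopies in the punctured space\<close>

definition nonzero :: "nat \<Rightarrow> (nat \<Rightarrow> real) set" where
  "nonzero d = {y. \<exists>j<d. y j \<noteq> 0}"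

lemma sphere_base_in_unit_sphere: "sphere_base \<in> unit_sphere k"
proof -
  have "(\<Sum>i\<le>k. (sphere_base i)\<^sup>2) = (\<Sum>i\<le>k. if i = 0 then 1 else 0)"
    by (intro sum.cong) (auto simp: sphere_base_def)
  then show ?thesis by (simp add: unit_sphere_def sphere_base_def)
qed

text \<open>A straight homotopy leads from \<open>f\<close> to a nearby map \<open>G\<close> that
  has no zero on the whole cube. Then the sphere is contracted to its base point inside the cube and
  \<open>G\<close> is applied. Both homotopies fix the base value.\<close>

lemma nullhomotopic_into_nonzero:
  assumes kd: "k + 1 < d" and f: "continuous_on (unit_sphere k) f" "f ` unit_sphere k \<subseteq> nonzero d"
  shows "homotopic_with (\<lambda>h. h sphere_base = f sphere_base) (nsphere k)
           (top_of_set (nonzero d)) f (\<lambda>_. f sphere_base)"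
proof -
  define b where "b = sphere_base"
  have b: "b \<in> unit_sphere k" by (simp add: b_def sphere_base_in_unit_sphere)
  note bbox = subsetD[OF unit_sphere_subset_cube b]
  have cf: "continuous_on (unit_sphere k) (\<lambda>x. f x j)" for j
    by (rule continuous_on_product_then_coordinatewise[OF f(1)])
  obtain \<delta> where \<delta>: "0 < \<delta>" "\<And>x. x \<in> unit_sphere k \<Longrightarrow> \<exists>j<d. \<delta> \<le> \<bar>f x j\<bar>"
  proof -
    have c: "continuous_on (unit_sphere k) (\<lambda>x. \<Sum>j<d. \<bar>f x j\<bar>)" by (intro continuous_intros cf)
    obtain x0 where x0: "x0 \<in> unit_sphere k" "\<And>x. x \<in> unit_sphere k \<Longrightarrow> (\<Sum>j<d. \<bar>f x0 j\<bar>) \<le> (\<Sum>j<d. \<bar>f x j\<bar>)"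
      using continuous_attains_inf[OF compact_unit_sphere _ c] b by blast
    define \<mu> where "\<mu> = (\<Sum>j<d. \<bar>f x0 j\<bar>)"
    obtain j where "j < d" "f x0 j \<noteq> 0" using f(2) x0(1) by (auto simp: nonzero_def)
    then have "0 < \<mu>" unfolding \<mu>_def by (intro sum_pos2[of _ j]) auto
    show thesis
    proof (rule that[of "\<mu> / d"])
      show "0 < \<mu> / d" using \<open>0 < \<mu>\<close> kd by simp
      fix x assume x: "x \<in> unit_sphere k"
      show "\<exists>j<d. \<mu> / d \<le> \<bar>f x j\<bar>"
      proof (rule ccontr)
        assume "\<not> ?thesis"
        then have "(\<Sum>j<d. \<bar>f x j\<bar>) < (\<Sum>j<d. \<mu> / d)"
          using kd by (intro sum_strict_mono) (auto simp: not_le)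
        then show False using x0(2)[OF x] kd by (simp add: \<mu>_def)
      qed
    qed
  qed
  have "\<exists>g L. continuous_on UNIV g \<and> lip_cube k g L \<and> (\<forall>x\<in>unit_sphere k. \<bar>f x j - g x\<bar> < \<delta> / 8)" for j
    using \<delta> by (intro lipschitz_approximation cf) auto
  then obtain g0 L0 where g0: "\<And>j. continuous_on UNIV (g0 j)" "\<And>j. lip_cube k (g0 j) (L0 j)"
      "\<And>j x. x \<in> unit_sphere k \<Longrightarrow> \<bar>f x j - g0 j x\<bar> < \<delta> / 8"
    by metis
  define L where "L = (\<Sum>j<d. \<bar>L0 j\<bar>) + 1"
  define g where "g j y = g0 j y + (f b j - g0 j b)" for j y
  have L: "0 < L" by (simp add: L_def add_nonneg_pos sum_nonneg)
  have lg: "lip_cube k (g j) L" if "j < d" for j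
  proof -
    have "\<bar>L0 j\<bar> \<le> (\<Sum>j<d. \<bar>L0 j\<bar>)" using that by (intro member_le_sum) auto
    then have "lip_cube k (g0 j) L" by (intro lip_cube_mono[OF g0(2)[of j]]) (simp add: L_def)
    then show ?thesis by (simp add: lip_cube_def g_def)
  qed
  have gf: "\<bar>f x j - g j x\<bar> < \<delta> / 4" if "x \<in> unit_sphere k" for x j
    using g0(3)[OF that, of j] g0(3)[OF b, of j] unfolding g_def by linarith
  \<comment> \<open>The factor \<open>q\<close> vanishes at \<open>b\<close>, so the perturbation
    keeps the base value. Up to distance \<open>\<delta> / (4 * L)\<close> from \<open>b\<close> the
    Lipschitz bound excludes zeros; beyond it the choice of \<open>v\<close> does.\<close>
  define q where "q y = ell1 k y b" for y
  \<comment> \<open>Since \<open>q\<close> is at most \<open>2 * (real k + 1)\<close> on the cube,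
    the perturbation stays below or at \<open>\<delta> / 4\<close>.\<close>
  define \<eta> where "\<eta> = \<delta> / (8 * (real k + 1))"
  have q: "lip_cube k q 1" by (simp add: lip_cube_def q_def ell1_triangle)
  have q0: "0 \<le> q y" "q b = 0" for y by (auto simp: q_def ell1_nonneg) (simp add: ell1_def)
  have pos: "0 < \<delta> / (4 * L)" "0 < \<eta>" using \<delta> L by (simp_all add: \<eta>_def)
  obtain v where v: "\<And>j. 0 \<le> v j \<and> v j \<le> \<eta>"
    "\<And>y. y \<in> cube k \<Longrightarrow> \<delta> / (4 * L) \<le> q y \<Longrightarrow> \<exists>j<d. g j y + v j * q y \<noteq> 0"
    using perturb_to_avoid_zero[where g = g, OF kd less_imp_le[OF L] lg q pos] by blast
  have vq: "0 \<le> v j * q y \<and> v j * q y \<le> \<delta> / 4" if "y \<in> cube k" for j y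
  proof -
    have "v j * q y \<le> \<eta> * (2 * (real k + 1))"
      using v(1)[of j] q0(1)[of y] pos ell1_le_cube[OF that bbox] by (intro mult_mono) (auto simp: q_def)
    also have "\<dots> = \<delta> / 4" by (simp add: \<eta>_def field_simps)
    finally show ?thesis using v(1)[of j] q0(1)[of y] by simp
  qed
  \<comment> \<open>Coordinates from \<open>d\<close> on do not affect membership in
    \<open>nonzero d\<close>; they are frozen so that \<open>G b = f b\<close> as functions.\<close>
  define G where "G y j = (if j < d then g j y + v j * q y else f b j)" for y j
  have cq: "continuous_on UNIV q"
    unfolding q_def ell1_def by (intro continuous_intros continuous_on_product_coordinates)
  have cg: "continuous_on UNIV (g j)" for j
    unfolding g_def by (intro continuous_intros g0(1))
  have cG: "continuous_on UNIV G"
  proof (rule continuous_on_coordinatewise_then_product)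
    show "continuous_on UNIV (\<lambda>y. G y j)" for j
      unfolding G_def by (cases "j < d") (auto intro!: continuous_intros cg cq)
  qed
  have Gb: "G b = f b" by (simp add: fun_eq_iff G_def g_def q0(2))
  have Gnz: "G y \<in> nonzero d" if y: "y \<in> cube k" for y
  proof (cases "\<delta> / (4 * L) \<le> q y")
    case True
    then show ?thesis using v(2)[OF y] by (auto simp: nonzero_def G_def)
  next
    case False
    obtain j where j: "j < d" "\<delta> \<le> \<bar>f b j\<bar>" using \<delta>(2)[OF b] by blast
    have "\<bar>g j y - g j b\<bar> \<le> L * q y" using lg[OF j(1)] y bbox by (simp add: lip_cube_def q_def)
    also have "\<dots> \<le> L * (\<delta> / (4 * L))" using False L by (intro mult_left_mono) auto
    also have "\<dots> = \<delta> / 4" using L by simp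
    finally have "\<bar>g j y - f b j\<bar> \<le> \<delta> / 4" by (simp add: g_def)
    then have "g j y + v j * q y \<noteq> 0"
      using j(2) vq[OF y, of j] \<delta>(1) by linarith
    then show ?thesis using j by (auto simp: nonzero_def G_def)
  qed
  have "homotopic_with (\<lambda>h. h b = f b) (nsphere k) (top_of_set (nonzero d)) f G"
    unfolding homotopic_with_def nsphere_eq prod_topology_subtopology_eu continuous_map_subtopology_eu
  proof (intro exI[of _ "\<lambda>(t, x) j. (1 - t) * f x j + t * G x j"] conjI allI ballI)
    show "continuous_on ({0..1} \<times> unit_sphere k) (\<lambda>(t, x) j. (1 - t) * f x j + t * G x j)"
      unfolding case_prod_unfold
      by (intro continuous_on_coordinatewise_then_product continuous_intros
          continuous_on_compose2[OF cf] continuous_on_compose2[OF continuous_on_product_then_coordinatewise[OF cG]])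
        auto
    have "(\<lambda>j. (1 - t) * f x j + t * G x j) \<in> nonzero d" if t01: "0 \<le> t" "t \<le> 1" and x: "x \<in> unit_sphere k" for t x
    proof -
      obtain j where j: "j < d" "\<delta> \<le> \<bar>f x j\<bar>" using \<delta>(2)[OF x] by blast
      have Gxj: "G x j = g j x + v j * q x" using j(1) by (simp add: G_def)
      \<comment> \<open>In a coordinate where \<open>f x\<close> has size at least \<delta> the
        segment moves by at most half of that.\<close>
      have "\<bar>f x j - G x j\<bar> \<le> \<delta> / 2"
        using gf[OF x, of j] vq[OF subsetD[OF unit_sphere_subset_cube x], of j] Gxj by linarith
      then have "t * \<bar>f x j - G x j\<bar> \<le> 1 * (\<delta> / 2)" using t01 by (intro mult_mono) auto
      then have "\<bar>t * (f x j - G x j)\<bar> < \<bar>f x j\<bar>"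
        using j(2) \<delta>(1) t01 by (simp add: abs_mult)
      then have "(1 - t) * f x j + t * G x j \<noteq> 0" by (auto simp: algebra_simps)
      then show ?thesis using j by (auto simp: nonzero_def)
    qed
    then show "(\<lambda>(t, x) j. (1 - t) * f x j + t * G x j) \<in> {0..1} \<times> unit_sphere k \<rightarrow> nonzero d" by auto
  qed (auto simp: Gb fun_eq_iff algebra_simps)
  moreover have "homotopic_with (\<lambda>h. h b = f b) (nsphere k) (top_of_set (nonzero d)) G (\<lambda>_. f b)"
    unfolding homotopic_with_def nsphere_eq prod_topology_subtopology_eu continuous_map_subtopology_eu
  proof (intro exI[of _ "\<lambda>(t, x). G (\<lambda>i. (1 - t) * x i + t * b i)"] conjI allI ballI)
    have "continuous_on A (\<lambda>p. snd p i)" for A :: "(real \<times> (nat \<Rightarrow> real)) set" and i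
      by (rule continuous_on_compose2[where g = "\<lambda>x. x i" and f = snd and t = UNIV])
        (auto intro: continuous_on_product_coordinates continuous_on_snd continuous_on_id)
    then have "continuous_on ({0..1} \<times> unit_sphere k) (\<lambda>p i. (1 - fst p) * snd p i + fst p * b i)"
      by (intro continuous_on_coordinatewise_then_product continuous_on_add continuous_on_mult
          continuous_on_diff continuous_on_const continuous_on_fst continuous_on_id)
    then show "continuous_on ({0..1} \<times> unit_sphere k) (\<lambda>(t, x). G (\<lambda>i. (1 - t) * x i + t * b i))"
      unfolding case_prod_unfold by (rule continuous_on_compose2[OF cG]) simp
    have "(\<lambda>i. (1 - t) * x i + t * b i) \<in> cube k" if "0 \<le> t" "t \<le> 1" "x \<in> unit_sphere k" for t x
    proof -
      have "\<bar>(1 - t) * x i + t * b i\<bar> \<le> 1" if "i \<le> k" for i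
      proof -
        have "\<bar>x i\<bar> \<le> 1" "\<bar>b i\<bar> \<le> 1"
          using \<open>x \<in> unit_sphere k\<close> unit_sphere_subset_cube[of k] bbox that by (auto simp: cube_def)
        then have "(1 - t) * \<bar>x i\<bar> + t * \<bar>b i\<bar> \<le> (1 - t) * 1 + t * 1"
          (is "_ \<le> ?r") using \<open>0 \<le> t\<close> \<open>t \<le> 1\<close> by (intro add_mono mult_left_mono) auto
        moreover have "\<bar>(1 - t) * x i + t * b i\<bar> \<le> (1 - t) * \<bar>x i\<bar> + t * \<bar>b i\<bar>"
          using abs_triangle_ineq[of "(1 - t) * x i" "t * b i"] \<open>0 \<le> t\<close> \<open>t \<le> 1\<close> by (simp add: abs_mult)
        moreover have "?r = 1" by simp
        ultimately show ?thesis by linarith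
      qed
      then show ?thesis by (simp add: cube_def)
    qed
    then show "(\<lambda>(t, x). G (\<lambda>i. (1 - t) * x i + t * b i)) \<in> {0..1} \<times> unit_sphere k \<rightarrow> nonzero d"
      using Gnz by auto
  qed (auto simp: Gb algebra_simps)
  ultimately show ?thesis unfolding b_def by (rule homotopic_with_trans)
qed

text \<open>Push a sphere map forward by \<phi>, contract it there, and bring the homotopy back by
  \<psi>.\<close>

lemma trivial_homotopy_retract_nonzero:
  assumes "k + 1 < d"
    and \<phi>: "continuous_on X \<phi>" "\<phi> ` X \<subseteq> nonzero d"
    and \<psi>: "continuous_on (nonzero d) \<psi>" "\<psi> ` nonzero d \<subseteq> X"
    and inv: "\<And>a. a \<in> X \<Longrightarrow> \<psi> (\<phi> a) = a"
  shows "trivial_homotopy k (top_of_set X)"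
  unfolding trivial_homotopy_iff
proof (intro ballI)
  fix x0 f assume x0: "x0 \<in> topspace (top_of_set X)" and "f \<in> pointed_sphere_maps k (top_of_set X) x0"
  then have f: "continuous_on (unit_sphere k) f" "f \<in> unit_sphere k \<rightarrow> X" "f sphere_base = x0"
    by (auto simp: pointed_sphere_maps_def nsphere_eq continuous_map_subtopology_eu)
  have "continuous_on (unit_sphere k) (\<phi> \<circ> f)"
    using f \<phi>(1) by (intro continuous_on_compose) (auto intro: continuous_on_subset)
  moreover have "(\<phi> \<circ> f) ` unit_sphere k \<subseteq> nonzero d" using f \<phi>(2) by auto
  ultimately have "homotopic_with (\<lambda>h. h sphere_base = (\<phi> \<circ> f) sphere_base) (nsphere k)
      (top_of_set (nonzero d)) (\<phi> \<circ> f) (\<lambda>_. (\<phi> \<circ> f) sphere_base)"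
    by (rule nullhomotopic_into_nonzero[OF assms(1)])
  then have "homotopic_with (\<lambda>h. h sphere_base = x0) (nsphere k) (top_of_set X)
      (\<psi> \<circ> (\<phi> \<circ> f)) (\<psi> \<circ> (\<lambda>_. (\<phi> \<circ> f) sphere_base))"
    by (rule homotopic_with_compose_continuous_map_left)
      (use \<psi> inv x0 f(3) in \<open>auto simp: continuous_map_subtopology_eu\<close>)
  then show "homotopic_with (\<lambda>h. h sphere_base = x0) (nsphere k) (top_of_set X) f (\<lambda>_. x0)"
    by (rule homotopic_with_eq) (use inv f x0 sphere_base_in_unit_sphere[of k] in \<open>auto simp: nsphere_eq Pi_iff\<close>)
qed

section \<open>Connectivity of the join of cycles\<close>

text \<open>
  The plane is the union of the cones spanned by neighbouring \<open>p\<close>-th roots of unity. By Cramer's rule,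
  \<open>hat p g u1 u2\<close> is the coefficient at the \<open>g\<close>-th root when the vector is written as a nonnegative
  combination of the two roots spanning its cone.
\<close>

definition hat :: "nat \<Rightarrow> nat \<Rightarrow> real \<Rightarrow> real \<Rightarrow> real" where
  "hat p g u1 u2 = max 0 (min
     (u1 * sin (2 * pi / p * (real g + 1)) - u2 * cos (2 * pi / p * (real g + 1)))
     (u2 * cos (2 * pi / p * (real g - 1)) - u1 * sin (2 * pi / p * (real g - 1)))) / sin (2 * pi / p)"

text \<open>Both Cramer numerators depend only on the offset \<open>d\<close> of \<open>g\<close>
  from \<open>h\<close> modulo \<open>p\<close>. Offsets 0 and 1 return \<open>x\<close> and
  \<open>y\<close>. At any other offset one numerator is nonpositive: \<open>B\<close> on the first
  half of the circle, \<open>A\<close> on the second.\<close>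

lemma hat_cone:
  assumes p: "5 \<le> p" and gh: "g < p" "h < p" and xy: "0 \<le> x" "0 \<le> y"
    and u: "u1 = x * cos (2 * pi / p * h) + y * cos (2 * pi / p * (real h + 1))"
           "u2 = x * sin (2 * pi / p * h) + y * sin (2 * pi / p * (real h + 1))"
  shows "hat p g u1 u2 = (if g = h then x else 0) + (if g = Suc h mod p then y else 0)"
proof -
  define \<beta> where "\<beta> = 2 * pi / p"
  have \<beta>p: "\<beta> * real p = 2 * pi" and \<beta>0: "0 < \<beta>" using p by (simp_all add: \<beta>_def)
  have \<beta>5: "5 * \<beta> \<le> 2 * pi" unfolding \<beta>p[symmetric] using p \<beta>0 by (simp add: mult.commute)
  have s\<beta>: "0 < sin \<beta>" using \<beta>0 \<beta>5 pi_gt_zero by (intro sin_gt_zero) linarith+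
  have s2\<beta>: "0 \<le> sin (2 * \<beta>)" using \<beta>0 \<beta>5 by (intro sin_ge_zero) linarith+
  obtain d where d: "d < p" "d + h = g \<or> d + h = g + p"
    using that[of "g - h"] that[of "g + p - h"] gh by (cases "h \<le> g") auto
  then have "real d + real h = real g \<or> real d + real h = real g + real p" by (metis of_nat_add)
  then have dr: "real d = real g - real h \<or> real d = real g - real h + real p" by auto
  have per: "sin (\<beta> * (real g - real h + c)) = sin (\<beta> * (real d + c))" for c
    using dr
  proof
    assume eq: "real d = real g - real h + real p"
    have "\<beta> * (real d + c) = \<beta> * (real g - real h + c) + 2 * pi"
      unfolding eq \<beta>p[symmetric] by (simp add: algebra_simps)
    then show ?thesis by simp
  qed simp
  define A where "A = u1 * sin (\<beta> * (real g + 1)) - u2 * cos (\<beta> * (real g + 1))"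
  define B where "B = u2 * cos (\<beta> * (real g - 1)) - u1 * sin (\<beta> * (real g - 1))"
  have hat: "hat p g u1 u2 = max 0 (min A B) / sin \<beta>" by (simp add: hat_def A_def B_def \<beta>_def)
  have "A = x * sin (\<beta> * (real g + 1) - \<beta> * h) + y * sin (\<beta> * (real g + 1) - \<beta> * (real h + 1))"
    unfolding A_def u \<beta>_def[symmetric] sin_diff by (simp add: algebra_simps)
  also have "\<beta> * (real g + 1) - \<beta> * h = \<beta> * (real g - real h + 1)" by (simp add: algebra_simps)
  also have "\<beta> * (real g + 1) - \<beta> * (real h + 1) = \<beta> * (real g - real h + 0)" by (simp add: algebra_simps)
  finally have A: "A = x * sin (\<beta> * (real d + 1)) + y * sin (\<beta> * real d)"
    unfolding per by simp
  have "B = - (x * sin (\<beta> * (real g - 1) - \<beta> * h) + y * sin (\<beta> * (real g - 1) - \<beta> * (real h + 1)))"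
    unfolding B_def u \<beta>_def[symmetric] sin_diff by (simp add: algebra_simps)
  also have "\<beta> * (real g - 1) - \<beta> * h = \<beta> * (real g - real h + (-1))" by (simp add: algebra_simps)
  also have "\<beta> * (real g - 1) - \<beta> * (real h + 1) = \<beta> * (real g - real h + (-2))" by (simp add: algebra_simps)
  finally have B: "B = - (x * sin (\<beta> * (real d - 1)) + y * sin (\<beta> * (real d - 2)))"
    unfolding per by simp
  have gd: "g = h \<longleftrightarrow> d = 0" "g = Suc h mod p \<longleftrightarrow> d = 1"
  proof -
    show "g = h \<longleftrightarrow> d = 0" using d gh by auto
    show "g = Suc h mod p \<longleftrightarrow> d = 1"
    proof (cases "Suc h = p")
      case True
      then show ?thesis using d gh p by auto
    next
      case False
      then have "Suc h mod p = Suc h" using gh by simp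
      then show ?thesis using d gh p by auto
    qed
  qed
  consider "d = 0" | "d = 1" | "2 \<le> d" "2 * d \<le> p + 2" | "2 \<le> d" "p + 2 \<le> 2 * d" by linarith
  then show ?thesis
  proof cases
    case 1
    then have "A = x * sin \<beta>" "B = x * sin \<beta> + y * sin (2 * \<beta>)" unfolding A B by (simp_all add: mult.commute)
    then have "max 0 (min A B) = x * sin \<beta>"
      using xy s\<beta> s2\<beta> mult_nonneg_nonneg[of y "sin (2 * \<beta>)"] mult_nonneg_nonneg[of x "sin \<beta>"] by simp
    then show ?thesis using 1 s\<beta> by (simp add: hat gd)
  next
    case 2
    then have "A = x * sin (2 * \<beta>) + y * sin \<beta>" "B = y * sin \<beta>" unfolding A B by (simp_all add: mult.commute)
    then have "max 0 (min A B) = y * sin \<beta>"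
      using xy s\<beta> s2\<beta> mult_nonneg_nonneg[of x "sin (2 * \<beta>)"] mult_nonneg_nonneg[of y "sin \<beta>"] by simp
    then show ?thesis using 2 s\<beta> by (simp add: hat gd)
  next
    case 3
    have r: "2 * (real d - 1) \<le> real p" "2 \<le> real d" 
      using 3 of_nat_mono[of "2 * d" "p + 2", where 'a = real] by simp_all
    have "2 * (\<beta> * (real d - 1)) \<le> \<beta> * p"
      using mult_left_mono[OF r(1) less_imp_le[OF \<beta>0]] by (simp only: mult.left_commute)
    then have "\<beta> * (real d - 1) \<le> pi" unfolding \<beta>p by simp
    moreover have "0 \<le> \<beta> * (real d - 1)" "0 \<le> \<beta> * (real d - 2)"
      using \<beta>0 r by simp_all
    moreover have "\<beta> * (real d - 2) \<le> \<beta> * (real d - 1)" using \<beta>0 by simp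
    ultimately have "0 \<le> sin (\<beta> * (real d - 1))" "0 \<le> sin (\<beta> * (real d - 2))"
      by (auto intro!: sin_ge_zero)
    then have "0 \<le> x * sin (\<beta> * (real d - 1)) + y * sin (\<beta> * (real d - 2))"
      using xy by (intro add_nonneg_nonneg mult_nonneg_nonneg)
    then have "B \<le> 0" unfolding B by simp
    then show ?thesis using 3 by (simp add: hat gd max_def min_def)
  next
    case 4
    have r: "real p \<le> 2 * (real d - 1)" "real d + 1 \<le> p"
      using 4 d(1) of_nat_mono[of "p + 2" "2 * d", where 'a = real] of_nat_mono[of "Suc d" p, where 'a = real] by simp_all
    have "\<beta> * p \<le> 2 * (\<beta> * (real d - 1))" "\<beta> * (real d + 1) \<le> \<beta> * p"
      using mult_left_mono[OF r(1) less_imp_le[OF \<beta>0]] mult_left_mono[OF r(2) less_imp_le[OF \<beta>0]]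
      by (simp_all only: mult.left_commute)
    then have "pi \<le> \<beta> * (real d - 1)" "\<beta> * (real d + 1) \<le> 2 * pi" unfolding \<beta>p by simp_all
    moreover have "\<beta> * (real d - 1) \<le> \<beta> * real d" "\<beta> * real d \<le> \<beta> * (real d + 1)" using \<beta>0 by simp_all
    ultimately have "0 \<le> sin (\<beta> * (real d + 1) - pi)" "0 \<le> sin (\<beta> * real d - pi)"
      by (intro sin_ge_zero; linarith)+
    then have "sin (\<beta> * (real d + 1)) \<le> 0" "sin (\<beta> * real d) \<le> 0" by (simp_all add: sin_diff)
    then have "A \<le> 0" unfolding A using xy by (intro add_nonpos_nonpos mult_nonneg_nonpos)
    then show ?thesis using 4 by (simp add: hat gd max_def min_def)
  qed
qed

text \<open>In polar coordinates \<open>h\<close> is the number of the sector containing the angle,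
  and \<open>x\<close>, \<open>y\<close> come from Cramer's rule; they are nonnegative because the
  angle lies between the two roots.\<close>

lemma cone_exists:
  assumes p: "5 \<le> p"
  obtains h :: nat and x y where "h < p" "0 \<le> x" "0 \<le> y"
    "u1 = x * cos (2 * pi / p * h) + y * cos (2 * pi / p * (real h + 1))"
    "u2 = x * sin (2 * pi / p * h) + y * sin (2 * pi / p * (real h + 1))"
proof -
  define \<beta> where "\<beta> = 2 * pi / p"
  have \<beta>p: "\<beta> * real p = 2 * pi" and \<beta>0: "0 < \<beta>" using p by (simp_all add: \<beta>_def)
  have \<beta>5: "5 * \<beta> \<le> 2 * pi" unfolding \<beta>p[symmetric] using p \<beta>0 by (simp add: mult.commute)
  have s\<beta>: "0 < sin \<beta>" using \<beta>0 \<beta>5 pi_gt_zero by (intro sin_gt_zero) linarith+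
  obtain r t where rt: "0 \<le> r" "0 \<le> t" "t < 2 * pi" "u1 = r * cos t" "u2 = r * sin t"
  proof -
    define z where "z = Complex u1 u2"
    have z: "z = rcis (cmod z) (Arg2pi z)" by (metis Arg2pi_eq cis_conv_exp rcis_def)
    have "u1 = cmod z * cos (Arg2pi z)" using arg_cong[OF z, of Re] by (simp add: z_def)
    moreover have "u2 = cmod z * sin (Arg2pi z)" using arg_cong[OF z, of Im] by (simp add: z_def)
    ultimately show thesis by (rule that[OF norm_ge_zero Arg2pi_ge_0 Arg2pi_lt_2pi])
  qed
  define h where "h = nat \<lfloor>t / \<beta>\<rfloor>"
  have "0 \<le> t / \<beta>" using rt \<beta>0 by simp
  then have "real h \<le> t / \<beta>" "t / \<beta> < real h + 1" by (simp_all add: h_def)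
  then have h: "\<beta> * h \<le> t" "t < \<beta> * (real h + 1)" using \<beta>0 by (simp_all add: field_simps)
  have "\<beta> * h < \<beta> * p" using h rt \<beta>p by simp
  then have hp: "h < p" using \<beta>0 by simp
  define x where "x = r * sin (\<beta> * (real h + 1) - t) / sin \<beta>"
  define y where "y = r * sin (t - \<beta> * h) / sin \<beta>"
  have le: "\<beta> * (real h + 1) = \<beta> * h + \<beta>" by (simp add: algebra_simps)
  have x: "0 \<le> x" and y: "0 \<le> y"
    unfolding x_def y_def using h rt s\<beta> \<beta>5 le pi_gt_zero
    by (intro divide_nonneg_pos mult_nonneg_nonneg sin_ge_zero; linarith)+
  have key: "sin \<beta> = sin (\<beta> * (real h + 1)) * cos (\<beta> * h) - cos (\<beta> * (real h + 1)) * sin (\<beta> * h)"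
    using sin_diff[of "\<beta> * (real h + 1)" "\<beta> * h"] by (simp add: le)
  have "r * cos t * sin \<beta> = (r * sin (\<beta> * (real h + 1) - t)) * cos (\<beta> * h) + (r * sin (t - \<beta> * h)) * cos (\<beta> * (real h + 1))"
    unfolding key sin_diff by (simp add: algebra_simps)
  then have c: "u1 = x * cos (\<beta> * h) + y * cos (\<beta> * (real h + 1))"
    using s\<beta> by (simp add: rt x_def y_def field_simps)
  have "r * sin t * sin \<beta> = (r * sin (\<beta> * (real h + 1) - t)) * sin (\<beta> * h) + (r * sin (t - \<beta> * h)) * sin (\<beta> * (real h + 1))"
    unfolding key sin_diff by (simp add: algebra_simps)
  then have s: "u2 = x * sin (\<beta> * h) + y * sin (\<beta> * (real h + 1))"
    using s\<beta> by (simp add: rt x_def y_def field_simps)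
  show thesis using that[OF hp x y] c s by (simp add: \<beta>_def)
qed

text \<open>Cycle \<open>i\<close> becomes a regular polygon in the plane of the coordinates
  \<open>2 * i\<close> and \<open>2 * i + 1\<close>, and the join its affine extension.\<close>

definition to_plane :: "nat \<Rightarrow> (nat \<Rightarrow> real) \<Rightarrow> nat \<Rightarrow> real" where
  "to_plane p a j = (\<Sum>g<p. a (j div 2 * p + g) *
     (if even j then cos (2 * pi / p * g) else sin (2 * pi / p * g)))"

definition hats :: "nat \<Rightarrow> nat \<Rightarrow> (nat \<Rightarrow> real) \<Rightarrow> nat \<Rightarrow> real" where
  "hats p m y v = (if v < m * p then hat p (v mod p) (y (2 * (v div p))) (y (2 * (v div p) + 1)) else 0)"

text \<open>Hats are positively homogeneous, so normalising their sum is the radial projection onto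
  the join.\<close>

definition from_plane :: "nat \<Rightarrow> nat \<Rightarrow> (nat \<Rightarrow> real) \<Rightarrow> nat \<Rightarrow> real" where
  "from_plane p m y v = hats p m y v / (\<Sum>w<m * p. hats p m y w)"

lemma hats_nonneg: "5 \<le> p \<Longrightarrow> 0 \<le> hats p m y v"
proof -
  assume p: "5 \<le> p"
  have "2 * pi / real p \<le> pi" using p by (simp add: field_simps)
  then have "0 \<le> sin (2 * pi / real p)" by (intro sin_ge_zero) auto
  then show ?thesis by (simp add: hats_def hat_def)
qed

text \<open>Some plane component of \<open>y\<close> is nonzero, hence so is one of its two cone
  coefficients.\<close>

lemma hats_sum_pos:
  assumes p: "5 \<le> p" and y: "y \<in> nonzero (2 * m)"
  shows "0 < (\<Sum>w<m * p. hats p m y w)"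
proof -
  obtain j where j: "j < 2 * m" "y j \<noteq> 0" using y by (auto simp: nonzero_def)
  define i where "i = j div 2"
  have i: "i < m" "y (2 * i) \<noteq> 0 \<or> y (2 * i + 1) \<noteq> 0"
  proof -
    show "i < m" using j by (simp add: i_def less_mult_imp_div_less mult.commute)
    have "j = 2 * i \<or> j = 2 * i + 1" by (auto simp: i_def)
    then show "y (2 * i) \<noteq> 0 \<or> y (2 * i + 1) \<noteq> 0" using j by auto
  qed
  obtain h a b where c: "h < p" "0 \<le> a" "0 \<le> b"
    "y (2 * i) = a * cos (2 * pi / p * h) + b * cos (2 * pi / p * (real h + 1))"
    "y (2 * i + 1) = a * sin (2 * pi / p * h) + b * sin (2 * pi / p * (real h + 1))"
    using cone_exists[OF p] by metis
  have at: "hats p m y (i * p + g) = (if g = h then a else 0) + (if g = Suc h mod p then b else 0)"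
    if "g < p" for g
  proof -
    have "(i * p + g) div p = i" "(i * p + g) mod p = g" using that by simp_all
    moreover have "i * p + g < m * p"
      using \<open>(i * p + g) div p = i\<close> i(1) p by (simp flip: div_less_iff_less_mult)
    ultimately show ?thesis using hat_cone[OF p that c] by (simp add: hats_def)
  qed
  have "a \<noteq> 0 \<or> b \<noteq> 0" using i(2) c by auto
  then have "\<exists>g<p. 0 < hats p m y (i * p + g)"
  proof
    assume "a \<noteq> 0"
    then show ?thesis using at[of h] c by (intro exI[of _ h]) auto
  next
    assume "b \<noteq> 0"
    then show ?thesis using at[of "Suc h mod p"] c p by (intro exI[of _ "Suc h mod p"]) auto
  qed
  then obtain g where g: "g < p" "0 < hats p m y (i * p + g)" by blast
  then have "i * p + g < m * p" by (simp add: hats_def split: if_splits)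
  then show ?thesis using g hats_nonneg[OF p] by (intro sum_pos2[of _ "i * p + g"]) auto
qed

text \<open>In every plane the vector lies in a single cone, so only the two ends of one edge
  receive a nonzero hat.\<close>

lemma from_plane_polyhedron:
  assumes p: "5 \<le> p" and y: "y \<in> nonzero (2 * m)"
  shows "from_plane p m y \<in> polyhedron (cycle_join p m)"
proof -
  note S = hats_sum_pos[OF p y]
  have "\<forall>i. \<exists>h a b. h < p \<and> 0 \<le> a \<and> 0 \<le> b \<and>
    y (2 * i) = a * cos (2 * pi / p * h) + b * cos (2 * pi / p * (real h + 1)) \<and>
    y (2 * i + 1) = a * sin (2 * pi / p * h) + b * sin (2 * pi / p * (real h + 1))"
    using cone_exists[OF p] by metis
  then obtain h a b where c: "\<And>i. h i < p" "\<And>i. 0 \<le> a i" "\<And>i. 0 \<le> b i"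
    "\<And>i. y (2 * i) = a i * cos (2 * pi / p * h i) + b i * cos (2 * pi / p * (real (h i) + 1))"
    "\<And>i. y (2 * i + 1) = a i * sin (2 * pi / p * h i) + b i * sin (2 * pi / p * (real (h i) + 1))"
    by metis
  show ?thesis
  proof (rule polyhedron_cycle_joinI[where h = h])
    show "0 \<le> from_plane p m y v" for v
      using S hats_nonneg[OF p] by (simp add: from_plane_def)
    show "(\<Sum>v<m * p. from_plane p m y v) = 1"
      using S by (simp add: from_plane_def flip: sum_divide_distrib)
    fix v assume "from_plane p m y v \<noteq> 0"
    then have nz: "hats p m y v \<noteq> 0" by (simp add: from_plane_def)
    then show v: "v < m * p" by (simp add: hats_def split: if_splits)
    have "hat p (v mod p) (y (2 * (v div p))) (y (2 * (v div p) + 1)) \<noteq> 0"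
      using nz v by (simp add: hats_def)
    then show "v mod p = h (v div p) mod p \<or> v mod p = Suc (h (v div p)) mod p"
      using hat_cone[OF p _ c(1)[of "v div p"] c(2,3) c(4,5), of "v mod p"] p c(1)[of "v div p"]
      by (auto split: if_splits)
  qed
qed

text \<open>On each cycle \<open>a\<close> lives on one edge, so its image is already written as a
  nonnegative combination of two neighbouring roots, and the hats recover the coefficients.\<close>

lemma hats_to_plane:
  assumes p: "5 \<le> p" and a: "a \<in> polyhedron (cycle_join p m)"
  shows "hats p m (to_plane p a) = a"
proof
  fix v
  note aD = polyhedron_cycle_joinD[OF a]
  obtain h0 where h0: "\<And>v. a v \<noteq> 0 \<Longrightarrow> v mod p = h0 (v div p) mod p \<or> v mod p = Suc (h0 (v div p)) mod p"
    using aD(4) by blast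
  show "hats p m (to_plane p a) v = a v"
  proof (cases "v < m * p")
    case False
    then show ?thesis using aD(2)[of v] by (auto simp: hats_def)
  next
    case True
    define i where "i = v div p"
    define h where "h = h0 i mod p"
    have h: "h < p" using p by (simp add: h_def)
    define h' where "h' = Suc h mod p"
    have h': "h' < p" "h' \<noteq> h"
      using p h mod_Suc[of h p] by (auto simp: h'_def)
    have z: "a (i * p + g) = 0" if "g < p" "g \<noteq> h" "g \<noteq> h'" for g
    proof (rule ccontr)
      assume "a (i * p + g) \<noteq> 0"
      from h0[OF this] show False using that by (auto simp: h_def h'_def mod_Suc_eq)
    qed
    have two: "(\<Sum>g<p. a (i * p + g) * f g) = a (i * p + h) * f h + a (i * p + h') * f h'" for f :: "nat \<Rightarrow> real"
    proof -
      have "(\<Sum>g<p. a (i * p + g) * f g) = (\<Sum>g\<in>{h, h'}. a (i * p + g) * f g)"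
        using h h' z by (intro sum.mono_neutral_right) auto
      then show ?thesis using h' by simp
    qed
    \<comment> \<open>The edge from \<open>p - 1\<close> back to 0 closes up by the period
      \<open>2 * pi\<close>.\<close>
    have wrap: "cos (2 * pi / p * h') = cos (2 * pi / p * (real h + 1))"
               "sin (2 * pi / p * h') = sin (2 * pi / p * (real h + 1))"
    proof -
      have "real h + 1 = real h' \<or> (h' = 0 \<and> real h + 1 = real p)"
        using h by (cases "Suc h = p") (auto simp: h'_def mod_Suc)
      then show "cos (2 * pi / p * h') = cos (2 * pi / p * (real h + 1))"
               "sin (2 * pi / p * h') = sin (2 * pi / p * (real h + 1))"
        using p by auto
    qed
    have "to_plane p a (2 * i) = (\<Sum>g<p. a (i * p + g) * cos (2 * pi / p * g))"
      "to_plane p a (2 * i + 1) = (\<Sum>g<p. a (i * p + g) * sin (2 * pi / p * g))"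
      by (simp_all add: to_plane_def)
    then have "to_plane p a (2 * i) = a (i * p + h) * cos (2 * pi / p * h) + a (i * p + h') * cos (2 * pi / p * (real h + 1))"
      "to_plane p a (2 * i + 1) = a (i * p + h) * sin (2 * pi / p * h) + a (i * p + h') * sin (2 * pi / p * (real h + 1))"
      unfolding two wrap .
    then have "hat p (v mod p) (to_plane p a (2 * i)) (to_plane p a (2 * i + 1)) =
        (if v mod p = h then a (i * p + h) else 0) + (if v mod p = Suc h mod p then a (i * p + h') else 0)"
      using p aD(1) h by (intro hat_cone) auto
    also have "\<dots> = a (i * p + v mod p)"
      using z[of "v mod p"] p h' by (auto simp flip: h'_def)
    also have "i * p + v mod p = v" by (simp add: i_def)
    finally show ?thesis using True by (simp add: hats_def i_def)
  qed
qed

lemma from_plane_to_plane: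
  assumes "5 \<le> p" "a \<in> polyhedron (cycle_join p m)"
  shows "from_plane p m (to_plane p a) = a"
  using polyhedron_cycle_joinD(3)[OF assms(2)] hats_to_plane[OF assms]
  by (simp add: from_plane_def fun_eq_iff)

text \<open>If the image vanished, so would all its hats, which are the coordinates of
  \<open>a\<close>.\<close>

lemma to_plane_nonzero:
  assumes p: "5 \<le> p" and a: "a \<in> polyhedron (cycle_join p m)"
  shows "to_plane p a \<in> nonzero (2 * m)"
proof (rule ccontr)
  assume "to_plane p a \<notin> nonzero (2 * m)"
  then have z: "to_plane p a j = 0" if "j < 2 * m" for j using that by (auto simp: nonzero_def)
  have "a v = 0" for v
  proof (cases "v < m * p")
    case True
    then have "v div p < m" by (simp add: less_mult_imp_div_less)
    then have "hats p m (to_plane p a) v = 0" using z by (simp add: hats_def hat_def)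
    then show ?thesis by (simp add: hats_to_plane[OF p a])
  next
    case False
    then show ?thesis using polyhedron_cycle_joinD(2)[OF a] by blast
  qed
  then show False using polyhedron_cycle_joinD(3)[OF a] by simp
qed

lemma continuous_on_to_plane: "continuous_on X (to_plane p)"
  unfolding to_plane_def
  by (intro continuous_on_coordinatewise_then_product continuous_on_sum continuous_on_mult
      continuous_on_const continuous_on_subset[OF continuous_on_product_coordinates]) auto

lemma continuous_on_from_plane:
  assumes p: "5 \<le> p"
  shows "continuous_on (nonzero (2 * m)) (from_plane p m)"
proof -
  have y: "continuous_on (nonzero (2 * m)) (\<lambda>y::nat \<Rightarrow> real. y j)" for j
    by (rule continuous_on_subset[OF continuous_on_product_coordinates]) simp
  have "2 * pi / real p < pi" using p by (simp add: field_simps)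
  then have s: "sin (2 * pi / real p) \<noteq> 0" using p by (intro less_imp_neq[symmetric] sin_gt_zero) auto
  have h: "continuous_on (nonzero (2 * m)) (\<lambda>y. hats p m y v)" for v
  proof (cases "v < m * p")
    case True
    then show ?thesis
      unfolding hats_def hat_def
      by (simp only: if_True) (intro continuous_on_divide continuous_on_max continuous_on_min continuous_on_diff
          continuous_on_mult continuous_on_const y ballI s)
  next
    case False
    then show ?thesis unfolding hats_def by simp
  qed
  show ?thesis
    unfolding from_plane_def
  proof (intro continuous_on_coordinatewise_then_product continuous_on_divide continuous_on_sum h ballI)
    fix y assume "y \<in> nonzero (2 * m)"
    then show "(\<Sum>w<m * p. hats p m y w) \<noteq> 0" using hats_sum_pos[OF p] by force
  qed
qed

lemma trivial_homotopy_cycle_join: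
  assumes "5 \<le> p" "k + 1 < 2 * m"
  shows "trivial_homotopy k (realization (cycle_join p m))"
  unfolding realization_def
  by (rule trivial_homotopy_retract_nonzero[OF assms(2) continuous_on_to_plane[of _ p] _
        continuous_on_from_plane[OF assms(1)]])
    (use assms(1) in \<open>auto simp: to_plane_nonzero from_plane_polyhedron from_plane_to_plane\<close>)

lemma EZp_space_cycle_join:
  assumes "odd p" "5 \<le> p" "0 < m"
  shows "EZp_space p (2 * m - 1) (realization (cycle_join p m)) (turn p)"
  unfolding EZp_space_def
  using assms free_Zp_space_turn finite_complex_cycle_join has_dimension_cycle_join
    simplicial_map_turn trivial_homotopy_cycle_join
  by (auto intro!: exI[of _ "cycle_join p m"])

section \<open>The coindex\<close>

lemma coind_ge:
  assumes p: "odd p" "5 \<le> p" "2 * 4 ^ (m * (4 * m + 1)) \<le> p" and m: "0 < m"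
  shows "ereal (real (2 * m - 1)) \<le> coind p (top_of_set (periodic_points p Zsys shift)) shift"
proof -
  define X where "X = polyhedron (cycle_join p m)"
  let ?P = "periodic_points p Zsys shift"
  have p0: "0 < p" using p by simp
  obtain f where f: "equivariant_map (top_of_set X) (turn p) (top_of_set ?P) shift f"
    using equivariant_map_from_local_maxima[of p X "turn p" "height p m"] p0 continuous_on_turn
      turn_polyhedron[OF p0] turn_period[OF p0] continuous_on_height[OF m] height_peak[OF p]
    unfolding X_def by blast
  \<comment> \<open>The coindex of the empty space is -1 by convention, so a periodic point is
    needed: the image of any point of the join.\<close>
  have "(\<lambda>j. if j = 0 then 1 else 0) \<in> nonzero (2 * m)" using m by (auto simp: nonzero_def)
  then have "X \<noteq> {}" using from_plane_polyhedron[OF p(2)] unfolding X_def by blast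
  then have "?P \<noteq> {}"
    using f by (auto simp: equivariant_map_def continuous_map_subtopology_eu)
  moreover have "2 * m - 1 \<in> {n. \<exists>E S f. EZp_space p n E S \<and> equivariant_map E S (top_of_set ?P) shift f}"
    using EZp_space_cycle_join[OF p(1,2) m] f by (auto simp: X_def realization_def)
  ultimately show ?thesis
    unfolding coind_def by (simp only: topspace_euclidean_subtopology if_False) (rule SUP_upper)
qed

theorem theorem1p3:
  shows "((\<lambda>p::nat. coind p (top_of_set (periodic_points p Zsys shift)) shift) \<longlongrightarrow> \<infinity>)
           (inf at_top (principal {p. prime p}))"
  unfolding tendsto_PInfty eventually_inf_principal
proof
  fix r :: real
  \<comment> \<open>With \<open>m\<close> above both \<open>r\<close> and 1,
    \<open>2 * m - 1\<close> is at least \<open>m\<close> and hence exceeds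
    \<open>r\<close>.\<close>
  obtain m :: nat where m: "max r 1 < real m" using reals_Archimedean2 by blast
  then have m0: "0 < m" and rm: "r < real (2 * m - 1)" by (auto simp: of_nat_diff)
  have "ereal r < coind p (top_of_set (periodic_points p Zsys shift)) shift"
    if "max 5 (2 * 4 ^ (m * (4 * m + 1))) \<le> p" "prime p" for p
  proof -
    have "odd p" using that prime_odd_nat[of p] by simp
    then have "ereal (real (2 * m - 1)) \<le> coind p (top_of_set (periodic_points p Zsys shift)) shift"
      using that m0 by (intro coind_ge) auto
    then show ?thesis using rm by (meson ereal_less_le less_ereal.simps(1) order_less_le_trans)
  qed
  then show "\<forall>\<^sub>F p in at_top. p \<in> {p. prime p} \<longrightarrow>
      ereal r < coind p (top_of_set (periodic_points p Zsys shift)) shift"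
    using eventually_ge_at_top[of "max 5 (2 * 4 ^ (m * (4 * m + 1)))"] by (auto elim: eventually_mono)
qed

end
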